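(* Let $(X_k)_{k\ge 0}$ be a Markov chain with transition kernel $P$ on a measurable space $(E,\mathcal{E})$, and let $\mathcal{E}^0\subseteq\mathcal{E}$ be a countably generated sub-$\sigma$-field. Let $\lambda$ be a $P$-invariant probability measure. The following are equivalent. 1. (A.e. local ergodicity) $\|\mathbf{P}^x-\mathbf{P}^\lambda\|_{\mathcal{F}^0_{n,\infty}}\to 0$ as $n\to\infty$ for $\lambda$-a.e. $x$; or, equivalently, $\|\mathbf{P}^x-\mathbf{P}^{x'}\|_{\mathcal{F}^0_{n,\infty}}\to 0$ as $n\to\infty$ for $\lambda\otimes\lambda$-a.e. $(x,x')$. 2. (A.e. triviality of the local tail $\sigma$-field) For $\lambda\otimes\lambda$-a.e. $(x,x')$, we have $\mathbf{P}^x(A)=\mathbf{P}^x(A)^2=\mathbf{P}^{x'}(A)$ for all $A\in\mathcal{A}^0$. 3. (A.e. local irreducibility) For $\lambda\otimes\lambda$-a.e. $(x,x')$, there exists $n\ge 0$ such that $\|\mathbf{P}^x-\mathbf{P}^{x'}\|_{\mathcal{F}^0_{n,\infty}}<2$.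
   Context: $(E,\mathcal{E})$ is a measurable space, $\Omega=E^{\mathbb{Z}}$, $\mathcal{F}=\mathcal{E}^{\mathbb{Z}}$ (product $\sigma$-field), $X_k(\omega)=\omega(k)$ is the coordinate process, and $\mathcal{F}_+=\sigma\{X_k:k\ge 0\}$. $P:E\times\mathcal{E}\to[0,1]$ is a transition kernel, $\mathcal{P}(E)$ is the set of probability measures on $(E,\mathcal{E})$, and for $\mu\in\mathcal{P}(E)$, $\mathbf{P}^\mu$ is the probability measure on $\mathcal{F}_+$ under which $(X_k)_{k\ge 0}$ is Markov with transition kernel $P$ and initial law $X_0\sim\mu$; $\mathbf{P}^x=\mathbf{P}^{\delta_x}$ for $x\in E$. "$P$-invariant" means $\lambda P=\lambda$. Given the sub-$\sigma$-field $\mathcal{E}^0\subseteq\mathcal{E}$, define $\mathcal{F}^0_{m,n}=\bigvee_{m\le k\le n}X_k^{-1}(\mathcal{E}^0)$ for $m<n$ (with $n=\infty$ allowed, in which case $k$ ranges over all $m\le k<\infty$), and the local tail $\sigma$-field $\mathcal{A}^0=\bigcap_{n\ge 0}\mathcal{F}^0_{n,\infty}$. For probability measures $\mu,\nu$ and a $\sigma$-field $\mathcal{G}$, $\|\mu-\nu\|_{\mathcal{G}}=2\sup_{A\in\mathcal{G}}|\mu(A)-\nu(A)|$. *)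

theory Defs
  imports "HOL-Probability.Probability"
begin

definition countably_generated :: "'a set \<Rightarrow> 'a set set \<Rightarrow> bool" where
  "countably_generated S \<G> \<longleftrightarrow> (\<exists>\<C>. countable \<C> \<and> \<C> \<subseteq> Pow S \<and> \<G> = sigma_sets S \<C>)"

definition paths :: "'a measure \<Rightarrow> (int \<Rightarrow> 'a) set" where
  "paths E = space (PiM (UNIV :: int set) (\<lambda>_. E))"

text \<open>The join over \<open>k \<in> I\<close> of the \<open>\<sigma>\<close>-fields \<open>X\<^sub>k\<inverse>(\<G>)\<close> on the two-sided path space, where
  \<open>X\<^sub>k(\<omega>) = \<omega>(k)\<close>. The local fields take \<open>\<G> = \<E>\<^sup>0\<close>; the choice \<open>\<G> = sets E\<close> and
  \<open>I = {0..}\<close> gives \<open>\<F>\<^sub>+\<close>.\<close>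

definition coord_field :: "'a measure \<Rightarrow> 'a set set \<Rightarrow> int set \<Rightarrow> (int \<Rightarrow> 'a) set set" where
  "coord_field E \<G> I = sigma_sets (paths E) (\<Union>k\<in>I. {{\<omega> \<in> paths E. \<omega> k \<in> A} | A. A \<in> \<G>})"

definition local_future :: "'a measure \<Rightarrow> 'a set set \<Rightarrow> nat \<Rightarrow> (int \<Rightarrow> 'a) set set" where
  "local_future E \<E>0 n = coord_field E \<E>0 {int n..}"

definition local_tail :: "'a measure \<Rightarrow> 'a set set \<Rightarrow> (int \<Rightarrow> 'a) set set" where
  "local_tail E \<E>0 = (\<Inter>n. local_future E \<E>0 n)"

text \<open>The law, on \<open>\<F>\<^sub>+\<close>, of a Markov chain. The last conjunct is the Markov property
  \<open>\<^bold>P(X\<^bsub>n+1\<^esub> \<in> B | X\<^sub>0, \<dots>, X\<^sub>n) = P(X\<^sub>n, B)\<close>, written as the defining property of the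
  conditional probability.\<close>

definition is_markov_law :: "'a measure \<Rightarrow> ('a \<Rightarrow> 'a measure) \<Rightarrow> 'a measure \<Rightarrow> (int \<Rightarrow> 'a) measure \<Rightarrow> bool" where
  "is_markov_law E P \<mu> Q \<longleftrightarrow>
     prob_space Q \<and> space Q = paths E \<and> sets Q = coord_field E (sets E) {0..} \<and>
     distr Q E (\<lambda>\<omega>. \<omega> 0) = \<mu> \<and>
     (\<forall>n::nat. \<forall>A \<in> coord_field E (sets E) {0..int n}. \<forall>B \<in> sets E.
        emeasure Q (A \<inter> {\<omega> \<in> paths E. \<omega> (int n + 1) \<in> B}) =
        (\<integral>\<^sup>+ \<omega> \<in> A. emeasure (P (\<omega> (int n))) B \<partial>Q))"

text \<open>The law exists (by the Ionescu-Tulcea theorem) and is unique, so the description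
  \<open>markov_law\<close> below is proper for every kernel and every initial law.\<close>

lemma nn_integral_distr_target:
  "T \<in> M \<rightarrow>\<^sub>M N \<Longrightarrow> f \<in> borel_measurable N \<Longrightarrow> integral\<^sup>N (distr M N T) f = (\<integral>\<^sup>+ x. f (T x) \<partial>M)"
  by (rule nn_integral_distr) auto

lemma paths_iff: "\<omega> \<in> paths E \<longleftrightarrow> (\<forall>k. \<omega> k \<in> space E)"
  by (auto simp: paths_def space_PiM PiE_iff)

lemma coord_gen_Pow: "(\<Union>k\<in>I. {{\<omega> \<in> paths E. \<omega> k \<in> A} | A. A \<in> \<G>}) \<subseteq> Pow (paths E)"
  by auto

lemma sigma_algebra_coord_field: "sigma_algebra (paths E) (coord_field E \<G> I)"
  unfolding coord_field_def by (rule sigma_algebra_sigma_sets[OF coord_gen_Pow])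

lemma coord_field_mono: "I \<subseteq> J \<Longrightarrow> coord_field E \<G> I \<subseteq> coord_field E \<G> J"
  unfolding coord_field_def by (rule sigma_sets_mono') auto

lemma coord_in_field: "k \<in> I \<Longrightarrow> A \<in> \<G> \<Longrightarrow> {\<omega> \<in> paths E. \<omega> k \<in> A} \<in> coord_field E \<G> I"
  unfolding coord_field_def by (rule sigma_sets.Basic) auto

definition coord_sigma :: "'a measure \<Rightarrow> int set \<Rightarrow> (int \<Rightarrow> 'a) measure" where "coord_sigma E I = sigma (paths E) (coord_field E (sets E) I)"

lemma space_coord_sigma[simp]: "space (coord_sigma E I) = paths E"
  unfolding coord_sigma_def by (rule space_measure_of_conv)

lemma sets_coord_sigma[simp]: "sets (coord_sigma E I) = coord_field E (sets E) I"
  unfolding coord_sigma_def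
  by (rule sigma_algebra.sets_measure_of_eq[OF sigma_algebra_coord_field])

lemma measurable_coord:
  assumes "k \<in> I" shows "(\<lambda>\<omega>. \<omega> k) \<in> coord_sigma E I \<rightarrow>\<^sub>M E"
proof (rule measurableI)
  fix A assume "A \<in> sets E"
  moreover have "(\<lambda>\<omega>. \<omega> k) -` A \<inter> space (coord_sigma E I) = {\<omega> \<in> paths E. \<omega> k \<in> A}" by auto
  ultimately show "(\<lambda>\<omega>. \<omega> k) -` A \<inter> space (coord_sigma E I) \<in> sets (coord_sigma E I)"
    using coord_in_field[OF assms, of A "sets E" E] by (simp del: space_coord_sigma)
qed (auto simp: paths_iff)

lemma is_markov_law_unique:
  assumes P: "P \<in> E \<rightarrow>\<^sub>M prob_algebra E"
    and Q: "is_markov_law E P \<mu> Q" and R: "is_markov_law E P \<mu> R"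
  shows "Q = R"
proof -
  interpret Q: prob_space Q using Q by (simp add: is_markov_law_def)
  interpret R: prob_space R using R by (simp add: is_markov_law_def)
  have sp: "space Q = paths E" "space R = paths E"
    and st: "sets Q = coord_field E (sets E) {0..}" "sets R = coord_field E (sets E) {0..}"
    using Q R by (auto simp: is_markov_law_def)
  have c0: "(\<lambda>\<omega>. \<omega> 0) \<in> Q \<rightarrow>\<^sub>M E" "(\<lambda>\<omega>. \<omega> 0) \<in> R \<rightarrow>\<^sub>M E"
    using measurable_coord[of 0 "{0..}" E] st
    by (auto simp: measurable_cong_sets[of Q "coord_sigma E {0..}" E E] measurable_cong_sets[of R "coord_sigma E {0..}" E E])
  let ?F = "\<lambda>n::nat. coord_field E (sets E) {0..int n}"
  have Fsub: "?F n \<subseteq> coord_field E (sets E) {0..}" for n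
    by (rule coord_field_mono) auto
  have Fmono: "m \<le> n \<Longrightarrow> ?F m \<subseteq> ?F n" for m n
    by (rule coord_field_mono) auto
  have FInt: "A \<inter> B \<in> ?F n" if "A \<in> ?F n" "B \<in> ?F n" for A B n
    using that sets.Int[of A "coord_sigma E {0..int n}" B] by simp
  have Fsp: "paths E \<in> ?F n" for n
    using sets.top[of "coord_sigma E {0..int n}"] by simp
  have eq: "A \<in> ?F n \<Longrightarrow> emeasure Q A = emeasure R A" for n A
  proof (induction n arbitrary: A)
    case 0
    let ?S = "{A. A \<in> ?F 0 \<and> (\<exists>B\<in>sets E. A = {\<omega> \<in> paths E. \<omega> 0 \<in> B})}"
    have "?F 0 = {{\<omega> \<in> paths E. \<omega> 0 \<in> B} | B. B \<in> sets E}"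
    proof -
      have e: "{{\<omega> \<in> paths E. \<omega> (0::int) \<in> B} | B. B \<in> sets E} = sets (vimage_algebra (paths E) (\<lambda>\<omega>. \<omega> 0) E)"
        by (subst sets_vimage_algebra2) (auto simp: paths_iff)
      have "?F 0 = sigma_sets (paths E) {{\<omega> \<in> paths E. \<omega> (0::int) \<in> B} | B. B \<in> sets E}"
        by (simp add: coord_field_def)
      also have "\<dots> = {{\<omega> \<in> paths E. \<omega> (0::int) \<in> B} | B. B \<in> sets E}"
        unfolding e using sets.sigma_sets_eq[of "vimage_algebra (paths E) (\<lambda>\<omega>. \<omega> (0::int)) E"] by simp
      finally show ?thesis .
    qed
    with 0 obtain B where B: "B \<in> sets E" "A = {\<omega> \<in> paths E. \<omega> 0 \<in> B}" by auto
    have "emeasure (distr Q E (\<lambda>\<omega>. \<omega> 0)) B = emeasure (distr R E (\<lambda>\<omega>. \<omega> 0)) B"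
      using Q R by (simp add: is_markov_law_def)
    moreover have "(\<lambda>\<omega>. \<omega> 0) -` B \<inter> paths E = A" using B by auto
    ultimately show ?case
      using B c0 by (simp add: emeasure_distr sp)
  next
    case (Suc n)
    let ?G = "{A \<inter> {\<omega> \<in> paths E. \<omega> (int n + 1) \<in> B} | A B. A \<in> ?F n \<and> B \<in> sets E}"
    have GP: "?G \<subseteq> Pow (paths E)" by auto
    have gen: "?F (Suc n) = sigma_sets (paths E) ?G"
    proof (rule antisym)
      show "?F (Suc n) \<subseteq> sigma_sets (paths E) ?G"
        unfolding coord_field_def[of _ _ "{0..int (Suc n)}"]
      proof (rule sigma_sets_mono, safe)
        fix k :: int and B assume k: "k \<in> {0..int (Suc n)}" and B: "B \<in> sets E"
        show "{\<omega> \<in> paths E. \<omega> k \<in> B} \<in> sigma_sets (paths E) ?G"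
        proof (cases "k \<le> int n")
          case True
          then have "{\<omega> \<in> paths E. \<omega> k \<in> B} \<in> ?F n" using k B by (intro coord_in_field) auto
          moreover have "{\<omega> \<in> paths E. \<omega> k \<in> B} = {\<omega> \<in> paths E. \<omega> k \<in> B} \<inter> {\<omega> \<in> paths E. \<omega> (int n + 1) \<in> space E}"
            by (auto simp: paths_iff)
          ultimately show ?thesis by (intro sigma_sets.Basic) blast
        next
          case False
          then have "k = int n + 1" using k by auto
          moreover have "{\<omega> \<in> paths E. \<omega> k \<in> B} = paths E \<inter> {\<omega> \<in> paths E. \<omega> k \<in> B}" by auto
          ultimately show ?thesis using Fsp[of n] B by (intro sigma_sets.Basic) blast
        qed
      qed
      have "?G \<subseteq> ?F (Suc n)"
      proof safe
        fix A B assume "A \<in> ?F n" "B \<in> sets E"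
        then show "A \<inter> {\<omega> \<in> paths E. \<omega> (int n + 1) \<in> B} \<in> ?F (Suc n)"
          using Fmono[of n "Suc n"] by (intro FInt coord_in_field) auto
      qed
      then show "sigma_sets (paths E) ?G \<subseteq> ?F (Suc n)"
        using sets.sigma_sets_subset[of ?G "coord_sigma E {0..int (Suc n)}"] by simp
    qed
    have stab: "Int_stable ?G"
    proof (rule Int_stableI, safe)
      fix A A' B B' assume "A \<in> ?F n" "A' \<in> ?F n" "B \<in> sets E" "B' \<in> sets E"
      then show "\<exists>Aa Ba. A \<inter> {\<omega> \<in> paths E. \<omega> (int n + 1) \<in> B} \<inter> (A' \<inter> {\<omega> \<in> paths E. \<omega> (int n + 1) \<in> B'}) =
        Aa \<inter> {\<omega> \<in> paths E. \<omega> (int n + 1) \<in> Ba} \<and> Aa \<in> ?F n \<and> Ba \<in> sets E"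
        by (intro exI[of _ "A \<inter> A'"] exI[of _ "B \<inter> B'"]) (auto intro: FInt)
    qed
    have subQ: "subalgebra Q (coord_sigma E {0..int n})" "subalgebra R (coord_sigma E {0..int n})"
      using Fsub by (auto simp: subalgebra_def sp st)
    have rest: "restr_to_subalg Q (coord_sigma E {0..int n}) = restr_to_subalg R (coord_sigma E {0..int n})"
      using Suc.IH subQ by (intro measure_eqI) (auto simp: sets_restr_to_subalg emeasure_restr_to_subalg)
    have Geq: "emeasure Q X = emeasure R X" if "X \<in> ?G" for X
    proof -
      from that obtain A B where X: "X = A \<inter> {\<omega> \<in> paths E. \<omega> (int n + 1) \<in> B}" and A: "A \<in> ?F n" and B: "B \<in> sets E"
        by auto
      have m: "(\<lambda>\<omega>. emeasure (P (\<omega> (int n))) B * indicator A \<omega>) \<in> borel_measurable (coord_sigma E {0..int n})"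
      proof (rule borel_measurable_times_ennreal)
        show "(\<lambda>\<omega>. emeasure (P (\<omega> (int n))) B) \<in> borel_measurable (coord_sigma E {0..int n})"
          using measurable_compose[OF measurable_coord[of "int n" "{0..int n}" E], of "\<lambda>x. emeasure (P x) B"]
            measurable_prob_algebraD[OF P] B by (auto simp: measurable_emeasure_kernel)
        show "indicator A \<in> borel_measurable (coord_sigma E {0..int n})"
          using A by (intro borel_measurable_indicator) simp
      qed
      have "emeasure Q X = (\<integral>\<^sup>+ \<omega> \<in> A. emeasure (P (\<omega> (int n))) B \<partial>Q)"
        using Q A B unfolding X is_markov_law_def by blast
      also have "\<dots> = (\<integral>\<^sup>+ \<omega> \<in> A. emeasure (P (\<omega> (int n))) B \<partial>R)"
        using nn_integral_subalgebra2[OF subQ(1) m] nn_integral_subalgebra2[OF subQ(2) m] rest by simp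
      also have "\<dots> = emeasure R X"
        using R A B unfolding X is_markov_law_def by force
      finally show ?thesis .
    qed
    have "paths E \<in> ?G"
      using Fsp[of n] by (auto intro!: exI[of _ "paths E"] exI[of _ "space E"] simp: paths_iff)
    have "restr_to_subalg Q (coord_sigma E {0..int (Suc n)}) = restr_to_subalg R (coord_sigma E {0..int (Suc n)})"
    proof -
      have s: "subalgebra Q (coord_sigma E {0..int (Suc n)})" "subalgebra R (coord_sigma E {0..int (Suc n)})"
        using Fsub by (auto simp: subalgebra_def sp st simp del: of_nat_Suc)
      show ?thesis
      proof (rule measure_eqI_generator_eq[OF stab GP, where A="\<lambda>_. paths E"])
        fix X assume "X \<in> ?G"
        then have "X \<in> ?F (Suc n)" using gen by (auto intro: sigma_sets.Basic simp del: of_nat_Suc)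
        then show "emeasure (restr_to_subalg Q (coord_sigma E {0..int (Suc n)})) X =
          emeasure (restr_to_subalg R (coord_sigma E {0..int (Suc n)})) X"
          using Geq[OF \<open>X \<in> ?G\<close>] s by (simp add: emeasure_restr_to_subalg del: of_nat_Suc)
      next
        show "sets (restr_to_subalg Q (coord_sigma E {0..int (Suc n)})) = sigma_sets (paths E) ?G"
          using s gen by (simp add: sets_restr_to_subalg del: of_nat_Suc)
        show "sets (restr_to_subalg R (coord_sigma E {0..int (Suc n)})) = sigma_sets (paths E) ?G"
          using s gen by (simp add: sets_restr_to_subalg del: of_nat_Suc)
        show "range (\<lambda>_. paths E) \<subseteq> ?G" using \<open>paths E \<in> ?G\<close> by blast
        show "(\<Union>i::nat. paths E) = paths E" by simp
        show "emeasure (restr_to_subalg Q (coord_sigma E {0..int (Suc n)})) (paths E) \<noteq> \<infinity>" for i :: nat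
          using s Fsp[of "Suc n"] by (simp add: emeasure_restr_to_subalg del: of_nat_Suc)
      qed
    qed
    moreover have "subalgebra Q (coord_sigma E {0..int (Suc n)})" "subalgebra R (coord_sigma E {0..int (Suc n)})"
        using Fsub by (auto simp: subalgebra_def sp st simp del: of_nat_Suc)
    ultimately show ?case
      using Suc.prems by (metis emeasure_restr_to_subalg sets_coord_sigma)
  qed
  let ?U = "\<Union>n. ?F n"
  have UP: "?U \<subseteq> Pow (paths E)"
    using sets.sets_into_space[of _ "coord_sigma E _"] by auto
  have gen: "coord_field E (sets E) {0..} = sigma_sets (paths E) ?U"
  proof (rule antisym)
    show "coord_field E (sets E) {0..} \<subseteq> sigma_sets (paths E) ?U"
      unfolding coord_field_def[of _ _ "{0..}"]
    proof (rule sigma_sets_mono', rule subsetI)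
      fix Y assume "Y \<in> (\<Union>k\<in>{0..}. {{\<omega> \<in> paths E. \<omega> k \<in> A} | A. A \<in> sets E})"
      then obtain k B where Y: "Y = {\<omega> \<in> paths E. \<omega> k \<in> B}" and k: "0 \<le> k" and B: "B \<in> sets E"
        by auto
      then have "Y \<in> ?F (nat k)"
        unfolding Y by (intro coord_in_field) auto
      then show "Y \<in> ?U" by blast
    qed
    show "sigma_sets (paths E) ?U \<subseteq> coord_field E (sets E) {0..}"
      using sets.sigma_sets_subset[of ?U "coord_sigma E {0..}"] Fsub by auto
  qed
  show "Q = R"
  proof (rule measure_eqI_generator_eq[OF _ UP, where A="\<lambda>_. paths E"])
    show "Int_stable ?U"
    proof (rule Int_stableI, safe)
      fix A B m n assume "A \<in> ?F m" "B \<in> ?F n"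
      then have "A \<in> ?F (max m n)" "B \<in> ?F (max m n)"
        using Fmono[of m "max m n"] Fmono[of n "max m n"] by auto
      then show "A \<inter> B \<in> ?U" using FInt by blast
    qed
    show "X \<in> ?U \<Longrightarrow> emeasure Q X = emeasure R X" for X using eq by blast
    show "sets Q = sigma_sets (paths E) ?U" "sets R = sigma_sets (paths E) ?U"
      using st gen by auto
    show "range (\<lambda>_. paths E) \<subseteq> ?U" using Fsp by blast
    show "emeasure Q (paths E) \<noteq> \<infinity>" for i :: nat by simp
  qed auto
qed


lemma coord_field_vimage:
  assumes "A \<in> coord_field E (sets E) {0..int n}"
  shows "\<exists>A'\<in>sets (PiM {0..<Suc n} (\<lambda>_. E)). A = {\<omega> \<in> paths E. (\<lambda>i\<in>{0..<Suc n}. \<omega> (int i)) \<in> A'}"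
proof -
  let ?\<phi> = "\<lambda>\<omega>::int\<Rightarrow>'a. \<lambda>i\<in>{0..<Suc n}. \<omega> (int i)"
  let ?M = "PiM {0..<Suc n} (\<lambda>_. E)"
  let ?V = "vimage_algebra (paths E) ?\<phi> ?M"
  have \<phi>: "?\<phi> \<in> paths E \<rightarrow> space ?M" by (auto simp: paths_iff space_PiM)
  have "coord_field E (sets E) {0..int n} \<subseteq> sets ?V"
    unfolding coord_field_def
  proof (rule sets.sigma_sets_subset[of _ ?V, simplified], safe)
    fix k :: int and B assume k: "k \<in> {0..int n}" and B: "B \<in> sets E"
    have "{v \<in> space ?M. v (nat k) \<in> B} \<in> sets ?M"
      using measurable_sets[OF measurable_component_singleton[of "nat k" "{0..<Suc n}" "\<lambda>_. E"] B] k
      by (auto simp: vimage_def Int_def conj_commute)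
    moreover have "{\<omega> \<in> paths E. \<omega> k \<in> B} = ?\<phi> -` {v \<in> space ?M. v (nat k) \<in> B} \<inter> paths E"
      using k \<phi> by auto
    ultimately show "{\<omega> \<in> paths E. \<omega> k \<in> B} \<in> sets ?V"
      by (simp only: in_vimage_algebra)
  qed
  with assms have "A \<in> sets ?V" by blast
  then obtain A' where "A' \<in> sets ?M" "A = ?\<phi> -` A' \<inter> paths E"
    using sets_vimage_algebra2[OF \<phi>] by auto
  then show ?thesis by (intro bexI[of _ A']) auto
qed

lemma is_markov_law_exists:
  assumes P: "P \<in> E \<rightarrow>\<^sub>M prob_algebra E" and \<mu>: "\<mu> \<in> space (prob_algebra E)"
  shows "\<exists>Q. is_markov_law E P \<mu> Q"
proof -
  define \<kappa> where "\<kappa> = (\<lambda>(i::nat) (w::nat \<Rightarrow> 'a). case i of 0 \<Rightarrow> \<mu> | Suc n \<Rightarrow> P (w n))"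
  have \<mu>': "prob_space \<mu>" "sets \<mu> = sets E" using \<mu> by (auto simp: space_prob_algebra)
  have P': "prob_space (P x)" "sets (P x) = sets E" if "x \<in> space E" for x
    using measurable_space[OF P that] by (auto simp: space_prob_algebra)
  note Pm = measurable_prob_algebraD[OF P]
  interpret IT: Ionescu_Tulcea \<kappa> "\<lambda>_. E"
  proof (rule Ionescu_Tulcea.intro)
    fix i
    show "\<kappa> i \<in> PiM {0..<i} (\<lambda>_. E) \<rightarrow>\<^sub>M subprob_algebra E"
    proof (cases i)
      case 0
      then show ?thesis using \<mu>'
        by (auto simp: \<kappa>_def space_subprob_algebra prob_space_imp_subprob_space)
    next
      case (Suc n)
      have "(\<lambda>w. P (w n)) \<in> PiM {0..<i} (\<lambda>_. E) \<rightarrow>\<^sub>M subprob_algebra E"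
        by (rule measurable_compose[OF _ Pm], rule measurable_component_singleton) (simp add: Suc)
      then show ?thesis by (simp add: \<kappa>_def Suc)
    qed
  next
    fix i :: nat and w :: "nat \<Rightarrow> 'a" assume "w \<in> space (PiM {0..<i} (\<lambda>_. E))"
    then show "prob_space (\<kappa> i w)"
      using \<mu>' P' by (cases i) (auto simp: \<kappa>_def space_PiM PiE_iff)
  qed
  have \<kappa>0: "\<kappa> 0 w = \<mu>" and \<kappa>S: "\<kappa> (Suc n) w = P (w n)" for n w
    by (simp_all add: \<kappa>_def)
  let ?L = IT.PF.lim
  let ?u = "\<lambda>_::nat. undefined :: 'a"
  let ?r = "\<lambda>n w. restrict w {0..<n::nat}"
  have sL[measurable_cong]: "sets ?L = sets (PiM UNIV (\<lambda>_. E))" by (rule IT.PF.sets_lim)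
  have spL: "space ?L = space (PiM UNIV (\<lambda>_. E))" by (rule sets_eq_imp_space_eq[OF sL])
  have u: "?u \<in> space (PiM {0..<0} (\<lambda>_. E))" by (simp add: space_PiM)
  have up: "IT.up_to {0..<n} = n" for n
  proof (rule antisym)
    show "IT.up_to {0..<n} \<le> n" using IT.up_to_iff_Ico[of "{0..<n}" n] by simp
    show "n \<le> IT.up_to {0..<n}" using IT.up_to[of "{0..<n}"] by auto
  qed
  have CI: "IT.CI {0..<n} = IT.C 0 n ?u" for n
    using IT.distr_C[OF order_refl u, of n] by (simp add: IT.CI_def up)
  have rm: "?r n \<in> ?L \<rightarrow>\<^sub>M PiM {0..<n} (\<lambda>_. E)" for n
    by (subst measurable_cong_sets[OF sL refl]) (auto intro!: measurable_restrict_subset)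
  have dist: "distr ?L (PiM {0..<n} (\<lambda>_. E)) (?r n) = IT.C 0 n ?u" for n
    using IT.distr_lim[of "{0..<n}"] CI[of n] by simp
  interpret L: prob_space ?L
    by (rule prob_space_distrD[OF rm[of 0]]) (subst dist, rule IT.prob_space_C[OF u])
  have rsp: "?r n w \<in> space (PiM {0..<n} (\<lambda>_. E))" if "w \<in> space ?L" for n w
    using measurable_space[OF rm that] .
  have key: "(\<integral>\<^sup>+ w. f (?r (Suc n) w) \<partial>?L) = (\<integral>\<^sup>+ w. (\<integral>\<^sup>+ x. f ((?r n w)(n := x)) \<partial>\<kappa> n (?r n w)) \<partial>?L)"
    if f: "f \<in> borel_measurable (PiM {0..<Suc n} (\<lambda>_. E))" for f n
  proof -
    have ePm: "IT.eP n \<in> PiM {0..<n} (\<lambda>_. E) \<rightarrow>\<^sub>M subprob_algebra (PiM {0..<Suc n} (\<lambda>_. E))"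
      by (rule IT.measurable_eP)
    have sC: "sets (IT.C 0 n ?u) = sets (PiM {0..<n} (\<lambda>_. E))"
      using IT.sets_C[OF u, of n] by simp
    have "(\<integral>\<^sup>+ w. f (?r (Suc n) w) \<partial>?L) = (\<integral>\<^sup>+ v. f v \<partial>IT.C 0 (Suc n) ?u)"
      unfolding dist[symmetric] by (rule nn_integral_distr_target[OF rm f, symmetric])
    also have "\<dots> = (\<integral>\<^sup>+ v. (\<integral>\<^sup>+ y. f y \<partial>IT.eP n v) \<partial>IT.C 0 n ?u)"
    proof -
      have "IT.C 0 (Suc n) ?u = IT.C 0 n ?u \<bind> IT.eP n" by simp
      moreover have "IT.eP n \<in> IT.C 0 n ?u \<rightarrow>\<^sub>M subprob_algebra (PiM {0..<Suc n} (\<lambda>_. E))"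
        using ePm by (simp add: measurable_cong_sets[OF sC refl])
      ultimately show ?thesis using nn_integral_bind[OF f] by metis
    qed
    also have "\<dots> = (\<integral>\<^sup>+ w. (\<integral>\<^sup>+ y. f y \<partial>IT.eP n (?r n w)) \<partial>?L)"
      unfolding dist[symmetric]
      by (rule nn_integral_distr_target[OF rm])
         (rule measurable_compose[OF ePm nn_integral_measurable_subprob_algebra[OF f]])
    also have "\<dots> = (\<integral>\<^sup>+ w. (\<integral>\<^sup>+ x. f ((?r n w)(n := x)) \<partial>\<kappa> n (?r n w)) \<partial>?L)"
      by (intro nn_integral_cong IT.nn_integral_eP rsp f) auto
    finally show ?thesis .
  qed
  define g where "g = (\<lambda>(w::nat \<Rightarrow> 'a) (k::int). w (nat k))"
  let ?S = "coord_sigma E {0..}"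
  define Q where "Q = distr ?L ?S g"
  have gsp: "g w \<in> paths E" if "w \<in> space ?L" for w
    using that by (auto simp: g_def paths_iff spL space_PiM PiE_iff)
  have cm: "{w \<in> space ?L. w i \<in> B} \<in> sets ?L" if "B \<in> sets E" for i B
    using measurable_sets[OF measurable_component_singleton[of i UNIV "\<lambda>_. E"] that]
    by (auto simp: sL spL vimage_def Int_def conj_commute)
  have gm: "g \<in> ?L \<rightarrow>\<^sub>M ?S"
  proof (rule measurable_sigma_sets)
    show "sets ?S = sigma_sets (paths E) (\<Union>k\<in>{0..}. {{\<omega> \<in> paths E. \<omega> k \<in> A} | A. A \<in> sets E})"
      by (simp add: coord_field_def)
    show "g \<in> space ?L \<rightarrow> paths E" using gsp by blast
    fix Y assume "Y \<in> (\<Union>k\<in>{0..}. {{\<omega> \<in> paths E. \<omega> k \<in> A} | A. A \<in> sets E})"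
    then obtain k B where Y: "Y = {\<omega> \<in> paths E. \<omega> k \<in> B}" "B \<in> sets E" by auto
    then have "g -` Y \<inter> space ?L = {w \<in> space ?L. w (nat k) \<in> B}"
      using gsp by (auto simp: g_def)
    then show "g -` Y \<inter> space ?L \<in> sets ?L" using cm Y by simp
  qed (rule coord_gen_Pow)
  have Qsp: "space Q = paths E" "sets Q = coord_field E (sets E) {0..}"
    by (auto simp: Q_def)
  have x0: "(\<lambda>\<omega>. \<omega> 0) \<in> ?S \<rightarrow>\<^sub>M E" by (rule measurable_coord) simp
  have init: "distr Q E (\<lambda>\<omega>. \<omega> 0) = \<mu>"
  proof (rule measure_eqI)
    fix B assume "B \<in> sets (distr Q E (\<lambda>\<omega>. \<omega> 0))"
    then have B: "B \<in> sets E" by simp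
    have "emeasure (distr Q E (\<lambda>\<omega>. \<omega> 0)) B = emeasure (distr ?L E (\<lambda>w. w 0)) B"
      unfolding Q_def by (subst distr_distr[OF x0 gm]) (simp add: g_def comp_def)
    also have "\<dots> = emeasure ?L {w \<in> space ?L. w 0 \<in> B}"
      using B by (subst emeasure_distr)
        (auto simp: vimage_def Int_def conj_commute measurable_cong_sets[OF sL refl])
    also have "\<dots> = (\<integral>\<^sup>+ w. indicator {w \<in> space ?L. w 0 \<in> B} w \<partial>?L)"
      by (rule nn_integral_indicator[OF cm[OF B], symmetric])
    also have "\<dots> = (\<integral>\<^sup>+ w. indicator B (?r (Suc 0) w 0) \<partial>?L)"
      by (intro nn_integral_cong) (auto split: split_indicator)
    also have "\<dots> = (\<integral>\<^sup>+ w. (\<integral>\<^sup>+ x. indicator B (((?r 0 w)(0 := x)) 0) \<partial>\<kappa> 0 (?r 0 w)) \<partial>?L)"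
      by (rule key) (rule measurable_compose[OF _ borel_measurable_indicator[OF B]], rule measurable_component_singleton, simp)
    also have "\<dots> = emeasure \<mu> B"
      using B by (simp add: \<kappa>0 \<mu>' L.emeasure_space_1[unfolded spL])
    finally show "emeasure (distr Q E (\<lambda>\<omega>. \<omega> 0)) B = emeasure \<mu> B" .
  qed (simp add: \<mu>')
  have markov: "emeasure Q (A \<inter> {\<omega> \<in> paths E. \<omega> (int n + 1) \<in> B}) =
        (\<integral>\<^sup>+ \<omega> \<in> A. emeasure (P (\<omega> (int n))) B \<partial>Q)"
    if A: "A \<in> coord_field E (sets E) {0..int n}" and B: "B \<in> sets E" for n A B
  proof -
    obtain A' where A': "A' \<in> sets (PiM {0..<Suc n} (\<lambda>_. E))"
      and Aeq: "A = {\<omega> \<in> paths E. (\<lambda>i\<in>{0..<Suc n}. \<omega> (int i)) \<in> A'}"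
      using coord_field_vimage[OF A] by blast
    have As: "A \<in> sets ?S" using A coord_field_mono[of "{0..int n}" "{0..}"] by auto
    have Bs: "{\<omega> \<in> paths E. \<omega> (int n + 1) \<in> B} \<in> sets ?S"
      using B by (simp add: coord_in_field)
    have gA: "indicator A (g w) = (indicator A' (?r (Suc n) w) :: ennreal)" if "w \<in> space ?L" for w
    proof -
      have "(\<lambda>i\<in>{0..<Suc n}. g w (int i)) = ?r (Suc n) w" by (auto simp: g_def fun_eq_iff)
      then show ?thesis using gsp[OF that] by (simp add: Aeq indicator_def)
    qed
    let ?f = "\<lambda>v. indicator A' (?r (Suc n) v) * indicator B (v (Suc n)) :: ennreal"
    have fm: "?f \<in> borel_measurable (PiM {0..<Suc (Suc n)} (\<lambda>_. E))"
    proof (rule borel_measurable_times_ennreal)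
      show "(\<lambda>v. indicator A' (?r (Suc n) v) :: ennreal) \<in> borel_measurable (PiM {0..<Suc (Suc n)} (\<lambda>_. E))"
        by (rule measurable_compose[OF _ borel_measurable_indicator[OF A']]) (rule measurable_restrict_subset, auto)
      show "(\<lambda>v. indicator B (v (Suc n)) :: ennreal) \<in> borel_measurable (PiM {0..<Suc (Suc n)} (\<lambda>_. E))"
        by (rule measurable_compose[OF _ borel_measurable_indicator[OF B]]) (rule measurable_component_singleton, auto)
    qed
    have "emeasure Q (A \<inter> {\<omega> \<in> paths E. \<omega> (int n + 1) \<in> B}) =
        (\<integral>\<^sup>+ \<omega>. indicator (A \<inter> {\<omega> \<in> paths E. \<omega> (int n + 1) \<in> B}) \<omega> \<partial>Q)"
      using As Bs by (subst nn_integral_indicator) (auto simp: Q_def simp del: sets_coord_sigma)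
    also have "\<dots> = (\<integral>\<^sup>+ w. indicator (A \<inter> {\<omega> \<in> paths E. \<omega> (int n + 1) \<in> B}) (g w) \<partial>?L)"
      unfolding Q_def using As Bs by (intro nn_integral_distr_target[OF gm]) (auto simp del: sets_coord_sigma)
    also have "\<dots> = (\<integral>\<^sup>+ w. ?f (?r (Suc (Suc n)) w) \<partial>?L)"
    proof (rule nn_integral_cong)
      fix w assume w: "w \<in> space ?L"
      have "?r (Suc n) (?r (Suc (Suc n)) w) = ?r (Suc n) w" by (auto simp: fun_eq_iff)
      moreover have "g w (int n + 1) = w (Suc n)"
        by (simp add: g_def nat_add_distrib)
      ultimately show "indicator (A \<inter> {\<omega> \<in> paths E. \<omega> (int n + 1) \<in> B}) (g w) = ?f (?r (Suc (Suc n)) w)"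
        using gsp[OF w] gA[OF w] by (auto simp: indicator_def of_bool_def split: if_splits)
    qed
    also have "\<dots> = (\<integral>\<^sup>+ w. (\<integral>\<^sup>+ x. ?f ((?r (Suc n) w)(Suc n := x)) \<partial>\<kappa> (Suc n) (?r (Suc n) w)) \<partial>?L)"
      by (rule key[OF fm])
    also have "\<dots> = (\<integral>\<^sup>+ w. emeasure (P (g w (int n))) B * indicator A (g w) \<partial>?L)"
    proof (rule nn_integral_cong)
      fix w assume w: "w \<in> space ?L"
      have wn: "w n \<in> space E" using w by (auto simp: spL space_PiM PiE_iff)
      have "?r (Suc n) ((?r (Suc n) w)(Suc n := x)) = ?r (Suc n) w" for x by (auto simp: fun_eq_iff)
      then have "(\<integral>\<^sup>+ x. ?f ((?r (Suc n) w)(Suc n := x)) \<partial>\<kappa> (Suc n) (?r (Suc n) w))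
         = (\<integral>\<^sup>+ x. indicator A' (?r (Suc n) w) * indicator B x \<partial>P (w n))"
        by (simp add: \<kappa>S)
      also have "\<dots> = indicator A' (?r (Suc n) w) * emeasure (P (w n)) B"
        using B P'(2)[OF wn] by (simp add: nn_integral_cmult)
      finally show "(\<integral>\<^sup>+ x. ?f ((?r (Suc n) w)(Suc n := x)) \<partial>\<kappa> (Suc n) (?r (Suc n) w)) =
          emeasure (P (g w (int n))) B * indicator A (g w)"
        using gA[OF w] by (simp add: g_def mult.commute)
    qed
    also have "\<dots> = (\<integral>\<^sup>+ \<omega> \<in> A. emeasure (P (\<omega> (int n))) B \<partial>Q)"
      unfolding Q_def
    proof (rule nn_integral_distr_target[OF gm, symmetric], rule borel_measurable_times_ennreal)
      show "(\<lambda>\<omega>. emeasure (P (\<omega> (int n))) B) \<in> borel_measurable ?S"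
        by (rule measurable_compose[OF measurable_coord measurable_emeasure_kernel[OF Pm B]]) simp
      show "indicator A \<in> borel_measurable ?S"
        using As by (intro borel_measurable_indicator)
    qed
    finally show ?thesis .
  qed
  have "prob_space Q" unfolding Q_def by (rule L.prob_space_distr[OF gm])
  with Qsp init markov have "is_markov_law E P \<mu> Q" by (auto simp: is_markov_law_def)
  then show ?thesis ..
qed

definition markov_law :: "'a measure \<Rightarrow> ('a \<Rightarrow> 'a measure) \<Rightarrow> 'a measure \<Rightarrow> (int \<Rightarrow> 'a) measure" where
  "markov_law E P \<mu> = (THE Q. is_markov_law E P \<mu> Q)"

lemma is_markov_law_markov_law:
  assumes "P \<in> E \<rightarrow>\<^sub>M prob_algebra E" "\<mu> \<in> space (prob_algebra E)"
  shows "is_markov_law E P \<mu> (markov_law E P \<mu>)"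
  unfolding markov_law_def
  by (rule theI') (use is_markov_law_exists[OF assms] is_markov_law_unique[OF assms(1)] in blast)

definition markov_law_at :: "'a measure \<Rightarrow> ('a \<Rightarrow> 'a measure) \<Rightarrow> 'a \<Rightarrow> (int \<Rightarrow> 'a) measure" where
  "markov_law_at E P x = markov_law E P (return E x)"

definition tv_on :: "'b set set \<Rightarrow> 'b measure \<Rightarrow> 'b measure \<Rightarrow> real" where
  "tv_on \<G> \<mu> \<nu> = 2 * (SUP A\<in>\<G>. \<bar>measure \<mu> A - measure \<nu> A\<bar>)"

end

theory Submission
  imports Defs
begin

text \<open>
  Let \<open>K x\<close> be the law of the chain started at \<open>x\<close>, let \<open>Q\<close> be the stationary law, and write \<open>T\<close> for
  the local tail field. Total variation distances on the decreasing futures converge to the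
  distance on \<open>T\<close>, and the latter is attained by some tail event (\<open>tv_on_tail\<close>). Ergodicity therefore
  says that \<open>K x\<close> and \<open>Q\<close>, or \<open>K x\<close> and \<open>K x'\<close>, agree on \<open>T\<close>; irreducibility says that \<open>K x\<close> and
  \<open>K x'\<close> are not mutually singular on \<open>T\<close>.

  Each tail event is a shifted tail event, so by the Markov property its conditional probability given
  the past up to time \<open>n\<close> is a function of the current state. These conditional probabilities become
  zero-one valued in the limit (\<open>tail_prob_variance_tendsto_0\<close>). If \<open>K x\<close> agrees with \<open>Q\<close> on \<open>T\<close>
  almost everywhere, they are constant, and \<open>Q\<close> is trivial on \<open>T\<close>, which gives triviality for almost
  every pair. Triviality makes \<open>K x\<close> and \<open>K x'\<close> agree on \<open>T\<close>, and averaging over \<open>x'\<close> returns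
  ergodicity. Clearly, agreement on \<open>T\<close> implies irreducibility.

  The substantial implication is from irreducibility to ergodicity. Irreducibility forces \<open>Q\<close> to be
  trivial on \<open>T\<close>: under stationarity, two independent starting points would otherwise, with a
  probability that does not depend on \<open>n\<close>, see conditional probabilities close to 0 and to 1, and the
  corresponding laws would be nearly singular (\<open>irreducible_imp_tail_trivial\<close>). However, triviality
  of \<open>Q\<close> only yields \<open>K x A = Q A\<close> outside a null set that depends on \<open>A\<close>. To make the null set
  uniform, let \<open>h x\<close> be half of the distance of \<open>K x\<close> and \<open>Q\<close> on \<open>T\<close>; it is measurable because
  the local field is countably generated. Where \<open>h x > 0\<close>, it is the \<open>K x\<close>-probability of a
  \<open>Q\<close>-null tail event. The conditional probabilities of this event are bounded by \<open>h\<close> at the current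
  state, have mean \<open>h x\<close> and are asymptotically equal to their squares. Hence \<open>h x\<close> is asymptotically
  at most the mean of \<open>h\<^sup>2\<close> at time \<open>n\<close>, and integrating against the invariant law shows that \<open>h\<close> is
  almost everywhere 0 or 1 (\<open>irreducible_imp_ergodic\<close>). The value 1 is excluded since it would make
  \<open>K x\<close> singular to almost every \<open>K x'\<close>.
\<close>

section \<open>Approximation by a generating algebra\<close>

text \<open>The good sets, those that members of \<open>G\<close> approximate to any accuracy, form a \<open>\<sigma>\<close>-field:
  symmetric differences are unchanged by complements, and a countable union is approximated by a
  finite one up to half of the error, whose members share the other half. Two measures are treated
  at once, so that a single approximant serves both sides of a total variation distance.\<close>

lemma sigma_sets_approx_algebra:
  assumes M: "finite_measure M" and N: "finite_measure N" and MN: "sets M = sets N"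
    and G: "algebra \<Omega> G" and gen: "sets M = sigma_sets \<Omega> G"
    and A: "A \<in> sets M" and e: "0 < (e::real)"
  shows "\<exists>B\<in>G. measure M (sym_diff A B) < e \<and> measure N (sym_diff A B) < e"
proof -
  interpret M: finite_measure M by fact
  interpret N: finite_measure N by fact
  interpret G: algebra \<Omega> G by fact
  have GM: "B \<in> sets M" "B \<in> sets N" if "B \<in> G" for B
    using that gen MN by (auto intro: sigma_sets.Basic)
  have "A \<in> sigma_sets \<Omega> G" using A gen by simp
  then have "\<forall>e>0. \<exists>B\<in>G. measure M (sym_diff A B) < e \<and> measure N (sym_diff A B) < e"
  proof induction
    case (Basic a)
    then show ?case by (intro allI impI bexI[of _ a]) auto
  next
    case Empty
    then show ?case by (intro allI impI bexI[of _ "{}"]) auto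
  next
    case (Compl a)
    have sub: "a \<subseteq> \<Omega>" using Compl.hyps G.space_closed by (rule_tac sigma_sets_into_sp) auto
    show ?case
    proof (intro allI impI)
      fix e :: real assume "0 < e"
      then obtain B where B: "B \<in> G" "measure M (sym_diff a B) < e" "measure N (sym_diff a B) < e"
        using Compl.IH by blast
      have "sym_diff (\<Omega> - a) (\<Omega> - B) = sym_diff a B"
        using sub B(1) G.space_closed by blast
      with B show "\<exists>B\<in>G. measure M (sym_diff (\<Omega> - a) B) < e \<and> measure N (sym_diff (\<Omega> - a) B) < e"
        by (intro bexI[of _ "\<Omega> - B"]) auto
    qed
  next
    case (Union a)
    have aM: "a i \<in> sets M" for i using Union.hyps gen by auto
    show ?case
    proof (intro allI impI)
      fix e :: real assume e: "0 < e"
      have part: "(\<Union>i<k. a i) \<in> sets M" for k using aM by auto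
      have inc: "incseq (\<lambda>k. \<Union>i<k. a i)" by (auto simp: incseq_def intro: order_less_le_trans)
      have U: "(\<Union>k. \<Union>i<k. a i) = (\<Union>i. a i)" by auto
      have "(\<lambda>k. measure M (\<Union>i<k. a i)) \<longlonglongrightarrow> measure M (\<Union>i. a i)"
        using M.finite_Lim_measure_incseq[OF _ inc] part U by auto
      moreover have "(\<lambda>k. measure N (\<Union>i<k. a i)) \<longlonglongrightarrow> measure N (\<Union>i. a i)"
        using N.finite_Lim_measure_incseq[OF _ inc] part U MN by auto
      ultimately have "\<forall>\<^sub>F k in sequentially. measure M (\<Union>i. a i) - e/2 < measure M (\<Union>i<k. a i)
          \<and> measure N (\<Union>i. a i) - e/2 < measure N (\<Union>i<k. a i)"
        using e by (intro eventually_conj order_tendstoD) auto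
      then obtain k where k: "measure M (\<Union>i. a i) - e/2 < measure M (\<Union>i<k. a i)"
          "measure N (\<Union>i. a i) - e/2 < measure N (\<Union>i<k. a i)"
        by (auto simp: eventually_sequentially)
      define d where "d = e / (2 * (real k + 1))"
      have d: "0 < d" and kd: "real k * d < e / 2" using e by (auto simp: d_def field_simps)
      have "\<forall>i. \<exists>B\<in>G. measure M (sym_diff (a i) B) < d \<and> measure N (sym_diff (a i) B) < d"
        using Union.IH d by blast
      then obtain B where B: "\<And>i. B i \<in> G" "\<And>i. measure M (sym_diff (a i) (B i)) < d"
          "\<And>i. measure N (sym_diff (a i) (B i)) < d" by metis
      have sub: "sym_diff (\<Union>i. a i) (\<Union>i<k. B i)
          \<subseteq> ((\<Union>i. a i) - (\<Union>i<k. a i)) \<union> (\<Union>i<k. sym_diff (a i) (B i))" by blast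
      have BU: "(\<Union>i<k. B i) \<in> G" using B(1) by auto
      have bd: "measure R (sym_diff (\<Union>i. a i) (\<Union>i<k. B i)) < e"
        if R: "finite_measure R" "sets R = sets M" and k': "measure R (\<Union>i. a i) - e/2 < measure R (\<Union>i<k. a i)"
          and B': "\<And>i. measure R (sym_diff (a i) (B i)) < d" for R
      proof -
        interpret R: finite_measure R by fact
        have [simp]: "a i \<in> sets R" "B i \<in> sets R" for i using aM GM B(1) R by auto
        have "measure R (sym_diff (\<Union>i. a i) (\<Union>i<k. B i))
            \<le> measure R ((\<Union>i. a i) - (\<Union>i<k. a i)) + measure R (\<Union>i<k. sym_diff (a i) (B i))"
          by (rule order_trans[OF R.finite_measure_mono[OF sub] measure_Un_le])
            (intro sets.Un sets.Diff sets.countable_UN sets.finite_UN; auto)+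
        also have "measure R ((\<Union>i. a i) - (\<Union>i<k. a i)) = measure R (\<Union>i. a i) - measure R (\<Union>i<k. a i)"
          by (intro R.finite_measure_Diff) auto
        also have "measure R (\<Union>i<k. sym_diff (a i) (B i)) \<le> (\<Sum>i<k. measure R (sym_diff (a i) (B i)))"
          by (intro R.finite_measure_subadditive_finite image_subsetI sets.Un sets.Diff) auto
        also have "\<dots> \<le> (\<Sum>i<k. d)" using B' by (intro sum_mono less_imp_le)
        also have "\<dots> = real k * d" by simp
        finally show ?thesis using k' kd by linarith
      qed
      show "\<exists>C\<in>G. measure M (sym_diff (\<Union>i. a i) C) < e \<and> measure N (sym_diff (\<Union>i. a i) C) < e"
        using BU bd[OF M refl k(1) B(2)] bd[OF N MN[symmetric] k(2) B(3)] by blast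
    qed
  qed
  with e show ?thesis by blast
qed

lemma (in finite_measure) measure_diff_le_sym_diff:
  assumes "A \<in> sets M" "B \<in> sets M"
  shows "\<bar>measure M A - measure M B\<bar> \<le> measure M (sym_diff A B)"
proof -
  have "measure M A \<le> measure M (B \<union> sym_diff A B)" "measure M B \<le> measure M (A \<union> sym_diff A B)"
    using assms by (auto intro!: finite_measure_mono)
  moreover have "measure M (B \<union> sym_diff A B) \<le> measure M B + measure M (sym_diff A B)"
    "measure M (A \<union> sym_diff A B) \<le> measure M A + measure M (sym_diff A B)"
    using assms by (auto intro!: measure_Un_le)
  ultimately show ?thesis by linarith
qed

text \<open>The algebra is obtained by iterating the single operation \<open>a, b \<mapsto> \<Omega> - a \<inter> b\<close> on pairs of
  sets already obtained; complements and intersections are both expressible by it.\<close>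

lemma countable_generating_algebra:
  assumes C: "countable C" "C \<subseteq> Pow \<Omega>"
  shows "\<exists>G. countable G \<and> algebra \<Omega> G \<and> sigma_sets \<Omega> G = sigma_sets \<Omega> C"
proof -
  define step where "step S = S \<union> (\<lambda>(a, b). \<Omega> - a \<inter> b) ` (S \<times> S)" for S :: "'a set set"
  define L where "L k = (step ^^ k) (insert \<Omega> C)" for k
  define G where "G = (\<Union>k. L k)"
  have LS: "L (Suc k) = step (L k)" for k by (simp add: L_def)
  have cL: "countable (L k)" for k
    by (induction k) (auto simp: L_def step_def C)
  have "L k \<subseteq> L (Suc k)" for k by (simp add: LS step_def)
  then have mono: "L i \<subseteq> L j" if "i \<le> j" for i j using that by (rule lift_Suc_mono_le)
  have LP: "L k \<subseteq> Pow \<Omega>" for k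
    by (induction k) (use C in \<open>auto simp: L_def step_def\<close>)
  have nand: "\<Omega> - a \<inter> b \<in> G" if "a \<in> G" "b \<in> G" for a b
  proof -
    obtain i j where "a \<in> L i" "b \<in> L j" using \<open>a \<in> G\<close> \<open>b \<in> G\<close> by (auto simp: G_def)
    then have "(a, b) \<in> L (max i j) \<times> L (max i j)" using mono[of i "max i j"] mono[of j "max i j"] by auto
    then have "\<Omega> - a \<inter> b \<in> L (Suc (max i j))" unfolding LS step_def by force
    then show ?thesis by (auto simp: G_def)
  qed
  have GP: "G \<subseteq> Pow \<Omega>" using LP by (auto simp: G_def)
  have "\<Omega> \<in> L 0" "C \<subseteq> L 0" by (auto simp: L_def)
  then have G0: "\<Omega> \<in> G" "C \<subseteq> G" by (auto simp: G_def)
  have co: "\<Omega> - a \<in> G" if "a \<in> G" for a using nand[OF that that] by simp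
  have alg: "algebra \<Omega> G"
    unfolding algebra_iff_Int
  proof (intro conjI ballI)
    show "{} \<in> G" using co[OF G0(1)] by simp
    fix a b assume ab: "a \<in> G" "b \<in> G"
    have "a \<inter> b = \<Omega> - (\<Omega> - a \<inter> b)" using ab GP by blast
    then show "a \<inter> b \<in> G" using co[OF nand[OF ab]] by simp
  qed (use GP co in auto)
  interpret S: sigma_algebra \<Omega> "sigma_sets \<Omega> C" by (rule sigma_algebra_sigma_sets[OF C(2)])
  have "L k \<subseteq> sigma_sets \<Omega> C" for k
  proof (induction k)
    case 0 then show ?case by (auto simp: L_def)
  next
    case (Suc k)
    then show ?case unfolding LS step_def by auto
  qed
  then have "sigma_sets \<Omega> G \<subseteq> sigma_sets \<Omega> C"
    by (intro sigma_sets_mono) (auto simp: G_def)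
  moreover have "sigma_sets \<Omega> C \<subseteq> sigma_sets \<Omega> G" using G0 by (intro sigma_sets_mono') auto
  moreover have "countable G" using cL by (auto simp: G_def)
  ultimately show ?thesis using alg by blast
qed

section \<open>Total variation on sub-\<open>\<sigma>\<close>-fields\<close>

lemma tv_on_upper:
  assumes "prob_space M" "prob_space N" "A \<in> F"
  shows "\<bar>measure M A - measure N A\<bar> \<le> tv_on F M N / 2"
proof -
  have "\<bar>measure M A - measure N A\<bar> \<le> 1" for A
    using prob_space.prob_le_1[OF assms(1), of A] prob_space.prob_le_1[OF assms(2), of A]
      measure_nonneg[of M A] measure_nonneg[of N A] by linarith
  then have "bdd_above ((\<lambda>A. \<bar>measure M A - measure N A\<bar>) ` F)"
    by (intro bdd_aboveI2)
  then show ?thesis unfolding tv_on_def using assms(3) by (auto intro: cSUP_upper)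
qed

lemma tv_on_least:
  assumes "F \<noteq> {}" "\<And>A. A \<in> F \<Longrightarrow> \<bar>measure M A - measure N A\<bar> \<le> c"
  shows "tv_on F M N \<le> 2 * c"
  unfolding tv_on_def using assms by (auto intro!: cSUP_least)

lemma tv_on_mono:
  assumes "prob_space M" "prob_space N" "F \<subseteq> F'" "F \<noteq> {}"
  shows "tv_on F M N \<le> tv_on F' M N"
  using tv_on_least[of F M N "tv_on F' M N / 2"] tv_on_upper[OF assms(1,2)] assms(3,4) by auto

lemma tv_on_nonneg:
  assumes "prob_space M" "prob_space N" "F \<noteq> {}"
  shows "0 \<le> tv_on F M N"
proof -
  obtain A where "A \<in> F" using assms(3) by blast
  from tv_on_upper[OF assms(1,2) this] show ?thesis by linarith
qed

lemma restrict_to_field: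
  assumes M: "prob_space M" and F: "sigma_algebra (space M) F" and FM: "F \<subseteq> sets M"
  defines "R \<equiv> restr_to_subalg M (sigma (space M) F)"
  shows "prob_space R" and "sets R = F" and "X \<in> F \<Longrightarrow> emeasure R X = emeasure M X"
proof -
  have sets: "sets (sigma (space M) F) = F" by (rule sigma_algebra.sets_measure_of_eq[OF F])
  have sub: "subalgebra M (sigma (space M) F)"
    using FM unfolding subalgebra_def sets by (simp add: space_measure_of_conv)
  show "prob_space R" unfolding R_def by (rule prob_space_restr_to_subalg[OF sub M])
  show "sets R = F" unfolding R_def sets_restr_to_subalg[OF sub] by (rule sets)
  show "emeasure R X = emeasure M X" if "X \<in> F"
    unfolding R_def by (rule emeasure_restr_to_subalg[OF sub]) (use that sets in simp)
qed

text \<open>The positive set of a Hahn decomposition for the restrictions to \<open>F\<close> attains the supremum.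
  The absolute value costs nothing, because passing to complements changes the sign.\<close>

lemma tv_on_Hahn:
  assumes M: "prob_space M" and N: "prob_space N" and F: "sigma_algebra (space M) F"
    and FM: "F \<subseteq> sets M" and MN: "sets M = sets N"
  shows "\<exists>A\<in>F. tv_on F M N = 2 * (measure M A - measure N A) \<and>
    (\<forall>B\<in>F. measure M B - measure N B \<le> measure M A - measure N A)"
proof -
  interpret M: prob_space M by fact
  interpret N: prob_space N by fact
  interpret F: sigma_algebra "space M" F by fact
  have sp: "space N = space M" using sets_eq_imp_space_eq[OF MN] by simp
  let ?M = "restr_to_subalg M (sigma (space M) F)" and ?N = "restr_to_subalg N (sigma (space N) F)"
  note RM = restrict_to_field[OF M F FM]
    and RN = restrict_to_field[OF N F[folded sp] FM[unfolded MN]]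
  note sM = RM(2) RN(2) and e = RM(3) RN(3)
  note fin = prob_space.finite_measure[OF RM(1)] prob_space.finite_measure[OF RN(1)]
  obtain Y where Y: "Y \<in> F" "\<And>X. X \<in> F \<Longrightarrow> X \<subseteq> Y \<Longrightarrow> emeasure N X \<le> emeasure M X"
      "\<And>X. X \<in> F \<Longrightarrow> X \<inter> Y = {} \<Longrightarrow> emeasure M X \<le> emeasure N X"
    using finite_unsigned_Hahn_decomposition[OF fin] sM e by auto
  have Y2: "measure N X \<le> measure M X" if "X \<in> F" "X \<subseteq> Y" for X
    using Y(2)[OF that] by (simp add: M.emeasure_eq_measure N.emeasure_eq_measure)
  have Y3: "measure M X \<le> measure N X" if "X \<in> F" "X \<inter> Y = {}" for X
    using Y(3)[OF that] by (simp add: M.emeasure_eq_measure N.emeasure_eq_measure)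
  have split: "measure R X = measure R (X \<inter> Z) + measure R (X - Z)"
    if "prob_space R" "sets R = sets M" "X \<in> F" "Z \<in> F" for R X Z
  proof -
    interpret R: prob_space R by fact
    have "X \<in> sets R" "Z \<in> sets R" using that FM by auto
    then show ?thesis
      using R.finite_measure_Union[of "X \<inter> Z" "X - Z"] by (auto simp: Int_Diff_Un)
  qed
  have max: "measure M B - measure N B \<le> measure M Y - measure N Y" if B: "B \<in> F" for B
  proof -
    have "measure M (B - Y) \<le> measure N (B - Y)" "measure N (Y - B) \<le> measure M (Y - B)"
      using B Y(1) by (auto intro!: Y2 Y3)
    then show ?thesis
      using split[OF M refl B Y(1)] split[OF N MN[symmetric] B Y(1)]
        split[OF M refl Y(1) B] split[OF N MN[symmetric] Y(1) B] by (simp add: Int_commute)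
  qed
  have "tv_on F M N \<le> 2 * (measure M Y - measure N Y)"
  proof (rule tv_on_least)
    show "F \<noteq> {}" using F.top by blast
    fix B assume B: "B \<in> F"
    have "measure M (space M - B) - measure N (space M - B) = measure N B - measure M B"
      using B FM MN M.prob_compl[of B] N.prob_compl[of B] sp by auto
    then show "\<bar>measure M B - measure N B\<bar> \<le> measure M Y - measure N Y"
      using max[OF B] max[OF F.compl_sets[OF B]] by linarith
  qed
  moreover have "2 * (measure M Y - measure N Y) \<le> tv_on F M N"
    using abs_le_D1[OF tv_on_upper[OF M N Y(1)]] by simp
  ultimately show ?thesis using Y(1) max by (intro bexI[of _ Y]) auto
qed

text \<open>Along a decreasing sequence of \<open>\<sigma>\<close>-fields the distances converge to the distance on the
  intersection, and the latter is attained. Martingales can be avoided: Hahn sets suffice. Write \<open>s = M - N\<close> and let \<open>H n\<close> be a Hahn set in \<open>F n\<close>. For \<open>B \<in> F m\<close>,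
  \<open>s (H m \<union> B) = s (H m) + s B - s (H m \<inter> B) \<ge> s B\<close> since \<open>H m\<close> is maximal in \<open>F m\<close>.
  Adding Hahn sets one by one, from late to early, therefore keeps \<open>s\<close> above the limit of the
  \<open>s (H n)\<close>, and so does the upper limit of the sequence \<open>H\<close>, which lies in every \<open>F n\<close>.\<close>

lemma tv_on_tail:
  assumes M: "prob_space M" and N: "prob_space N" and F: "\<And>n::nat. sigma_algebra (space M) (F n)"
    and FM: "\<And>n. F n \<subseteq> sets M" and MN: "sets M = sets N" and dec: "\<And>n. F (Suc n) \<subseteq> F n"
  obtains A where "A \<in> (\<Inter>n. F n)" "tv_on (\<Inter>n. F n) M N = 2 * (measure M A - measure N A)"
    "(\<lambda>n. tv_on (F n) M N) \<longlonglongrightarrow> 2 * (measure M A - measure N A)"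
proof -
  interpret M: prob_space M by fact
  interpret N: prob_space N by fact
  let ?s = "\<lambda>A. measure M A - measure N A"
  let ?T = "\<Inter>n. F n"
  have mono: "F j \<subseteq> F i" if "i \<le> j" for i j using dec that by (rule lift_Suc_antimono_le)
  have "\<forall>n. \<exists>A\<in>F n. tv_on (F n) M N = 2 * ?s A \<and> (\<forall>B\<in>F n. ?s B \<le> ?s A)"
    using tv_on_Hahn[OF M N F FM MN] by blast
  then obtain H where H: "\<And>n. H n \<in> F n" "\<And>n. tv_on (F n) M N = 2 * ?s (H n)"
    and Hmax: "\<And>n B. B \<in> F n \<Longrightarrow> ?s B \<le> ?s (H n)" by metis
  have HF: "H j \<in> F i" if "i \<le> j" for i j using H(1) mono[OF that] by blast
  have Hs: "H n \<in> sets M" "H n \<in> sets N" for n using H(1) FM MN by blast+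
  have "decseq (\<lambda>n. ?s (H n))" by (rule decseq_SucI) (use Hmax HF in auto)
  moreover have "- 1 \<le> ?s (H n)" for n
    using N.prob_le_1[of "H n"] measure_nonneg[of M "H n"] by linarith
  ultimately obtain t where t: "(\<lambda>n. ?s (H n)) \<longlonglongrightarrow> t" "\<And>n. t \<le> ?s (H n)"
    using decseq_convergent[of "\<lambda>n. ?s (H n)" "- 1"] by blast
  have modular: "?s (A \<union> B) + ?s (A \<inter> B) = ?s A + ?s B" if "A \<in> sets M" "B \<in> sets M" for A B
    using that MN M.finite_measure_Union'[of A B] N.finite_measure_Union'[of A B]
      M.finite_measure_Diff'[of B A] N.finite_measure_Diff'[of B A] by (simp add: Int_commute)
  have fin: "(\<Union>i\<in>{m..m+k}. H i) \<in> F m \<and> t \<le> ?s (\<Union>i\<in>{m..m+k}. H i)" for m k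
  proof (induction k arbitrary: m)
    case 0 then show ?case using H(1) t(2) by simp
  next
    case (Suc k)
    let ?U = "\<Union>i\<in>{Suc m..Suc m+k}. H i"
    interpret Fm: sigma_algebra "space M" "F m" by (rule F)
    have eq: "(\<Union>i\<in>{m..m+Suc k}. H i) = H m \<union> ?U"
    proof -
      have "{m..m+Suc k} = insert m {Suc m..Suc m+k}" by auto
      then show ?thesis by simp
    qed
    have U: "?U \<in> F m" "t \<le> ?s ?U" using Suc[of "Suc m"] dec by auto
    then have "?s (H m \<inter> ?U) \<le> ?s (H m)" using H(1) by (intro Hmax) auto
    moreover have "?s (H m \<union> ?U) + ?s (H m \<inter> ?U) = ?s (H m) + ?s ?U"
      using U FM[of m] Hs by (intro modular) auto
    ultimately show ?case unfolding eq using U H(1) by auto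
  qed
  define V where "V m = (\<Union>k. \<Union>i\<in>{m..m+k}. H i)" for m
  have V_alt: "V m = (\<Union>i\<in>{m..}. H i)" for m
    unfolding V_def by (auto, metis atLeastAtMost_iff atLeast_iff le_add_diff_inverse order_refl)
  have VF: "V m \<in> F i" if "i \<le> m" for i m
  proof -
    interpret sigma_algebra "space M" "F i" by (rule F)
    show ?thesis unfolding V_alt using HF that by auto
  qed
  have Vs: "V m \<in> sets M" for m using VF[of m m] FM by blast
  have V: "t \<le> ?s (V m)" for m
  proof -
    have inc: "incseq (\<lambda>k. \<Union>i\<in>{m..m+k}. H i)" by (intro monoI UN_mono) auto
    have "(\<lambda>k. ?s (\<Union>i\<in>{m..m+k}. H i)) \<longlonglongrightarrow> ?s (V m)"
      unfolding V_def
      by (intro tendsto_diff M.finite_Lim_measure_incseq N.finite_Lim_measure_incseq inc)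
        (use Hs in auto)
    then show ?thesis by (rule LIMSEQ_le_const) (use fin in auto)
  qed
  define A where "A = (\<Inter>m. V m)"
  have dV: "decseq V" unfolding V_alt by (intro antimonoI UN_mono) auto
  have A_alt: "A = (\<Inter>m\<in>{n..}. V m)" for n
  proof -
    have "V (max m n) \<subseteq> V m" for m using dV by (auto simp: decseq_def)
    then show ?thesis unfolding A_def by (auto, meson atLeast_iff max.cobounded2 subsetD)
  qed
  have AT: "A \<in> ?T"
  proof
    fix n
    interpret sigma_algebra "space M" "F n" by (rule F)
    show "A \<in> F n" unfolding A_alt[of n] using VF by (intro countable_INT') auto
  qed
  have "(\<lambda>m. ?s (V m)) \<longlonglongrightarrow> ?s A"
    unfolding A_def
    by (intro tendsto_diff M.finite_Lim_measure_decseq N.finite_Lim_measure_decseq dV) (use Vs MN in auto)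
  then have "t \<le> ?s A" by (rule LIMSEQ_le_const) (use V in auto)
  moreover have "?s A \<le> t"
    by (rule LIMSEQ_le_const[OF t(1)]) (use Hmax AT in auto)
  ultimately have tA: "t = ?s A" by simp
  have lim: "(\<lambda>n. tv_on (F n) M N) \<longlonglongrightarrow> 2 * ?s A"
    unfolding H(2) tA[symmetric] by (intro tendsto_mult tendsto_const t)
  have "tv_on ?T M N \<le> 2 * ?s A"
    by (rule LIMSEQ_le_const[OF lim]) (use AT in \<open>auto intro!: tv_on_mono[OF M N] exI[of _ 0]\<close>)
  moreover have "2 * ?s A \<le> tv_on ?T M N" using abs_le_D1[OF tv_on_upper[OF M N AT]] by simp
  ultimately show ?thesis using that[OF AT _ lim] by simp
qed

text \<open>This reduces the supremum to countably many sets when \<open>F\<close> is countably generated, which is what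
  makes total variation distances measurable in a parameter.\<close>

lemma tv_on_generating_algebra:
  assumes M: "prob_space M" and N: "prob_space N" and FM: "F \<subseteq> sets M" and MN: "sets M = sets N"
    and G: "algebra (space M) G" and gen: "F = sigma_sets (space M) G"
  shows "tv_on F M N = tv_on G M N"
proof (rule antisym)
  interpret G: algebra "space M" G by fact
  interpret F: sigma_algebra "space M" F unfolding gen using G.space_closed by (rule sigma_algebra_sigma_sets)
  have GF: "G \<subseteq> F" using gen by auto
  have ne: "G \<noteq> {}" using G.empty_sets by blast
  show "tv_on G M N \<le> tv_on F M N" by (rule tv_on_mono[OF M N GF ne])
  have sp: "space N = space M" using sets_eq_imp_space_eq[OF MN] by simp
  let ?M = "restr_to_subalg M (sigma (space M) F)" and ?N = "restr_to_subalg N (sigma (space N) F)"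
  note RM = restrict_to_field[OF M F.sigma_algebra_axioms FM]
    and RN = restrict_to_field[OF N F.sigma_algebra_axioms[folded sp] FM[unfolded MN]]
  note sM = RM(2) RN(2)
  have e: "measure ?M X = measure M X" "measure ?N X = measure N X" if "X \<in> F" for X
    using RM(3)[OF that] RN(3)[OF that] by (simp_all add: measure_def)
  interpret M: prob_space ?M by (rule RM(1))
  interpret N: prob_space ?N by (rule RN(1))
  have "\<bar>measure M A - measure N A\<bar> \<le> tv_on G M N / 2" if A: "A \<in> F" for A
  proof (rule field_le_epsilon)
    fix d :: real assume "0 < d"
    then obtain B where B: "B \<in> G" "measure ?M (sym_diff A B) < d/2" "measure ?N (sym_diff A B) < d/2"
      using sigma_sets_approx_algebra[OF M.finite_measure_axioms N.finite_measure_axioms _ G, of A "d/2"] sM gen A by auto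
    have BF: "B \<in> F" using B GF by blast
    have "\<bar>measure M A - measure M B\<bar> < d/2" "\<bar>measure N A - measure N B\<bar> < d/2"
      using M.measure_diff_le_sym_diff[of A B] N.measure_diff_le_sym_diff[of A B] B A BF sM e by auto
    then show "\<bar>measure M A - measure N A\<bar> \<le> tv_on G M N / 2 + d"
      using tv_on_upper[OF M N B(1)] by linarith
  qed
  then have "tv_on F M N \<le> 2 * (tv_on G M N / 2)" using F.top by (intro tv_on_least) auto
  then show "tv_on F M N \<le> tv_on G M N" by simp
qed

section \<open>The shift on the path space\<close>

definition path_shift :: "int \<Rightarrow> (int \<Rightarrow> 'a) \<Rightarrow> int \<Rightarrow> 'a" where
  "path_shift j \<omega> = (\<lambda>k. \<omega> (k + j))"

lemma path_shift_apply: "path_shift j \<omega> k = \<omega> (k + j)"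
  by (simp add: path_shift_def)

lemma path_shift_in_paths [simp]: "path_shift j \<omega> \<in> paths E \<longleftrightarrow> \<omega> \<in> paths E"
  unfolding path_shift_def paths_iff by (metis diff_add_cancel)

lemma shift_vimage_coord_field:
  assumes A: "A \<in> coord_field E \<G> I" and J: "\<And>k. k \<in> I \<Longrightarrow> k + j \<in> J"
  shows "{\<omega> \<in> paths E. path_shift j \<omega> \<in> A} \<in> coord_field E \<G> J"
proof -
  interpret sigma_algebra "paths E" "coord_field E \<G> J" by (rule sigma_algebra_coord_field)
  from A show ?thesis unfolding coord_field_def[of _ _ I]
  proof induction
    case (Basic a)
    then obtain k B where k: "k \<in> I" "B \<in> \<G>" "a = {\<omega> \<in> paths E. \<omega> k \<in> B}" by auto
    have eq: "{\<omega> \<in> paths E. path_shift j \<omega> \<in> a} = {\<omega> \<in> paths E. \<omega> (k + j) \<in> B}"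
      unfolding k(3) by (auto simp: path_shift_apply)
    show ?case unfolding eq by (rule coord_in_field[OF J[OF k(1)] k(2)])
  next
    case Empty then show ?case by simp
  next
    case (Compl a)
    have "{\<omega> \<in> paths E. path_shift j \<omega> \<in> paths E - a} = paths E - {\<omega> \<in> paths E. path_shift j \<omega> \<in> a}" by auto
    then show ?case using Compl.IH by auto
  next
    case (Union a)
    have "{\<omega> \<in> paths E. path_shift j \<omega> \<in> (\<Union>i. a i)} = (\<Union>i. {\<omega> \<in> paths E. path_shift j \<omega> \<in> a i})" by auto
    then show ?case using Union.IH by auto
  qed
qed

lemma measurable_shift:
  assumes "\<And>k. k \<in> I \<Longrightarrow> k + j \<in> J"
  shows "path_shift j \<in> coord_sigma E J \<rightarrow>\<^sub>M coord_sigma E I"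
proof (rule measurableI)
  fix A assume "A \<in> sets (coord_sigma E I)"
  then have "{\<omega> \<in> paths E. path_shift j \<omega> \<in> A} \<in> coord_field E (sets E) J"
    by (intro shift_vimage_coord_field[of A E _ I] assms) auto
  also have "{\<omega> \<in> paths E. path_shift j \<omega> \<in> A} = path_shift j -` A \<inter> space (coord_sigma E J)" by auto
  finally show "path_shift j -` A \<inter> space (coord_sigma E J) \<in> sets (coord_sigma E J)" by simp
qed auto

lemma coord_field_mono_field: "\<G> \<subseteq> \<H> \<Longrightarrow> coord_field E \<G> I \<subseteq> coord_field E \<H> I"
  unfolding coord_field_def by (intro sigma_sets_mono') fast

lemma coord_field_cylinders:
  fixes E :: "'a measure" and \<G> :: "'a set set"
  defines "U \<equiv> (\<Union>n. coord_field E \<G> {0..int n})"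
  shows "algebra (paths E) U" and "coord_field E \<G> {0..} = sigma_sets (paths E) U"
proof -
  let ?F = "\<lambda>n. coord_field E \<G> {0..int n}"
  have mono: "?F m \<subseteq> ?F n" if "m \<le> n" for m n using that by (intro coord_field_mono) auto
  interpret S: sigma_algebra "paths E" "coord_field E \<G> {0..}" by (rule sigma_algebra_coord_field)
  have sub: "?F n \<subseteq> coord_field E \<G> {0..}" for n by (rule coord_field_mono) auto
  show "algebra (paths E) U"
    unfolding algebra_iff_Int
  proof (intro conjI ballI)
    show "U \<subseteq> Pow (paths E)" using sub S.space_closed by (auto simp: U_def)
    interpret F0: sigma_algebra "paths E" "?F 0" by (rule sigma_algebra_coord_field)
    show "{} \<in> U" using F0.empty_sets unfolding U_def by blast
    fix a assume "a \<in> U"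
    then obtain m where m: "a \<in> ?F m" by (auto simp: U_def)
    interpret Fm: sigma_algebra "paths E" "?F m" by (rule sigma_algebra_coord_field)
    show "paths E - a \<in> U" using Fm.compl_sets[OF m] unfolding U_def by blast
    fix b assume "b \<in> U"
    then obtain n where n: "b \<in> ?F n" by (auto simp: U_def)
    interpret F: sigma_algebra "paths E" "?F (max m n)" by (rule sigma_algebra_coord_field)
    have "a \<inter> b \<in> ?F (max m n)"
      using m n mono[of m "max m n"] mono[of n "max m n"] by (intro F.Int) auto
    then show "a \<inter> b \<in> U" by (auto simp: U_def)
  qed
  show "coord_field E \<G> {0..} = sigma_sets (paths E) U"
  proof (rule antisym)
    show "coord_field E \<G> {0..} \<subseteq> sigma_sets (paths E) U"
      unfolding coord_field_def[of _ _ "{0..}"]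
    proof (rule sigma_sets_mono', rule subsetI)
      fix Y assume "Y \<in> (\<Union>k\<in>{0..}. {{\<omega> \<in> paths E. \<omega> k \<in> A} | A. A \<in> \<G>})"
      then obtain k A where "0 \<le> k" "A \<in> \<G>" "Y = {\<omega> \<in> paths E. \<omega> k \<in> A}" by auto
      then have "Y \<in> ?F (nat k)" by (auto intro!: coord_in_field)
      then show "Y \<in> U" unfolding U_def by blast
    qed
    show "sigma_sets (paths E) U \<subseteq> coord_field E \<G> {0..}"
      using sub by (intro S.sigma_sets_subset) (auto simp: U_def)
  qed
qed

lemma coord_field_countable_generator:
  assumes cg: "countably_generated (space E) \<G>" and I: "countable I"
  shows "\<exists>\<C>. countable \<C> \<and> \<C> \<subseteq> Pow (paths E) \<and> coord_field E \<G> I = sigma_sets (paths E) \<C>"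
proof -
  obtain \<D> where D: "countable \<D>" "\<D> \<subseteq> Pow (space E)" "\<G> = sigma_sets (space E) \<D>"
    using cg by (auto simp: countably_generated_def)
  let ?C = "(\<lambda>(k, B). {\<omega> \<in> paths E. \<omega> k \<in> B}) ` (I \<times> \<D>)"
  have "?C \<subseteq> Pow (paths E)" by auto
  then interpret S: sigma_algebra "paths E" "sigma_sets (paths E) ?C" by (rule sigma_algebra_sigma_sets)
  have "{\<omega> \<in> paths E. \<omega> k \<in> B} \<in> sigma_sets (paths E) ?C" if k: "k \<in> I" and B: "B \<in> \<G>" for k B
    using B unfolding D(3)
  proof induction
    case (Basic a) then show ?case using k by (intro sigma_sets.Basic) auto
  next
    case Empty then show ?case by simp
  next
    case (Compl a)
    have "{\<omega> \<in> paths E. \<omega> k \<in> space E - a} = paths E - {\<omega> \<in> paths E. \<omega> k \<in> a}" by (auto simp: paths_iff)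
    then show ?case using Compl.IH by auto
  next
    case (Union a)
    have "{\<omega> \<in> paths E. \<omega> k \<in> (\<Union>i. a i)} = (\<Union>i. {\<omega> \<in> paths E. \<omega> k \<in> a i})" by auto
    then show ?case using Union.IH by auto
  qed
  then have "coord_field E \<G> I \<subseteq> sigma_sets (paths E) ?C"
    unfolding coord_field_def by (intro S.sigma_sets_subset) auto
  moreover have "sigma_sets (paths E) ?C \<subseteq> coord_field E \<G> I"
    unfolding coord_field_def using D(3) by (intro sigma_sets_mono') auto
  ultimately show ?thesis using D(1) I by (intro exI[of _ ?C]) auto
qed

section \<open>Markov laws as a kernel, and the Markov property\<close>

lemma is_markov_lawD:
  assumes "is_markov_law E P \<mu> Q"
  shows "prob_space Q" "space Q = paths E" "sets Q = sets (coord_sigma E {0..})"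
    "distr Q E (\<lambda>\<omega>. \<omega> 0) = \<mu>"
    "A \<in> coord_field E (sets E) {0..int n} \<Longrightarrow> B \<in> sets E \<Longrightarrow>
      emeasure Q (A \<inter> {\<omega> \<in> paths E. \<omega> (int n + 1) \<in> B}) = (\<integral>\<^sup>+ \<omega> \<in> A. emeasure (P (\<omega> (int n))) B \<partial>Q)"
  using assms by (auto simp: is_markov_law_def)

lemma past_subset_future: "coord_field E \<G> {0..int n} \<subseteq> coord_field E \<G> {0..}"
  by (rule coord_field_mono) auto

text \<open>These generators are exactly the events whose probability the one-step Markov property gives.\<close>

lemma coord_field_Suc:
  fixes E :: "'a measure" and n :: nat
  defines "G \<equiv> {A \<inter> {\<omega> \<in> paths E. \<omega> (int n + 1) \<in> B} | A B. A \<in> coord_field E (sets E) {0..int n} \<and> B \<in> sets E}"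
  shows "coord_field E (sets E) {0..int (Suc n)} = sigma_sets (paths E) G"
    and "Int_stable G" and "G \<subseteq> Pow (paths E)"
proof -
  let ?F = "\<lambda>n. coord_field E (sets E) {0..int n}"
  interpret Fn: sigma_algebra "paths E" "?F n" by (rule sigma_algebra_coord_field)
  interpret FS: sigma_algebra "paths E" "?F (Suc n)" by (rule sigma_algebra_coord_field)
  show "G \<subseteq> Pow (paths E)" by (auto simp: G_def)
  show "Int_stable G"
  proof (rule Int_stableI)
    fix X Y assume "X \<in> G" "Y \<in> G"
    then obtain A B A' B' where "A \<in> ?F n" "A' \<in> ?F n" "B \<in> sets E" "B' \<in> sets E"
      and "X = A \<inter> {\<omega> \<in> paths E. \<omega> (int n + 1) \<in> B}" "Y = A' \<inter> {\<omega> \<in> paths E. \<omega> (int n + 1) \<in> B'}"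
      unfolding G_def by blast
    then show "X \<inter> Y \<in> G"
      unfolding G_def by (intro CollectI exI[of _ "A \<inter> A'"] exI[of _ "B \<inter> B'"]) auto
  qed
  have mono: "?F n \<subseteq> ?F (Suc n)" by (rule coord_field_mono) auto
  show "?F (Suc n) = sigma_sets (paths E) G"
  proof (rule antisym)
    show "?F (Suc n) \<subseteq> sigma_sets (paths E) G"
      unfolding coord_field_def[of _ _ "{0..int (Suc n)}"]
    proof (rule sigma_sets_mono', safe)
      fix k :: int and B assume k: "k \<in> {0..int (Suc n)}" and B: "B \<in> sets E"
      show "{\<omega> \<in> paths E. \<omega> k \<in> B} \<in> G"
      proof (cases "k \<le> int n")
        case True
        have "{\<omega> \<in> paths E. \<omega> k \<in> B} = {\<omega> \<in> paths E. \<omega> k \<in> B} \<inter> {\<omega> \<in> paths E. \<omega> (int n + 1) \<in> space E}"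
          by (auto simp: paths_iff)
        moreover have "{\<omega> \<in> paths E. \<omega> k \<in> B} \<in> ?F n" using True k B by (intro coord_in_field) auto
        ultimately show ?thesis unfolding G_def by blast
      next
        case False
        then have "k = int n + 1" using k by auto
        then have "{\<omega> \<in> paths E. \<omega> k \<in> B} = paths E \<inter> {\<omega> \<in> paths E. \<omega> (int n + 1) \<in> B}" by auto
        then show ?thesis unfolding G_def using Fn.top B by blast
      qed
    qed
    show "sigma_sets (paths E) G \<subseteq> ?F (Suc n)"
    proof (rule FS.sigma_sets_subset)
      show "G \<subseteq> ?F (Suc n)"
        unfolding G_def using mono by (auto intro!: FS.Int coord_in_field simp del: of_nat_Suc)
    qed
  qed
qed

locale markov_kernel =
  fixes E :: "'a measure" and P :: "'a \<Rightarrow> 'a measure"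
  assumes kernel: "P \<in> E \<rightarrow>\<^sub>M prob_algebra E"
begin

abbreviation "S \<equiv> coord_sigma E {0..}"
abbreviation "K \<equiv> markov_law_at E P"
abbreviation "Q \<equiv> markov_law E P"

lemma law_is_markov: "\<mu> \<in> space (prob_algebra E) \<Longrightarrow> is_markov_law E P \<mu> (Q \<mu>)"
  by (rule is_markov_law_markov_law[OF kernel])

lemma return_in_prob_algebra: "x \<in> space E \<Longrightarrow> return E x \<in> space (prob_algebra E)"
  by (simp add: space_prob_algebra prob_space_return)

lemmas law_at_is_markov = law_is_markov[OF return_in_prob_algebra, folded markov_law_at_def]
lemmas lawD = is_markov_lawD[OF law_is_markov]
lemmas law_atD = is_markov_lawD[OF law_at_is_markov]

lemma measurable_coord_law:
  assumes "sets R = sets S" "0 \<le> k" shows "(\<lambda>\<omega>. \<omega> k) \<in> R \<rightarrow>\<^sub>M E"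
  using measurable_coord[of k "{0..}" E] assms by (simp add: measurable_cong_sets[OF assms(1) refl])

lemma measurable_P_emeasure: "B \<in> sets E \<Longrightarrow> (\<lambda>x. emeasure (P x) B) \<in> borel_measurable E"
  by (rule measurable_emeasure_kernel[OF measurable_prob_algebraD[OF kernel]])

text \<open>Induction on the horizon: by the Markov property the probability of a generator with horizon
  \<open>n + 1\<close> is an integral over the past up to time \<open>n\<close>, hence measurable in the starting point by the
  induction hypothesis.\<close>

lemma measurable_law_at_past:
  "(\<lambda>x. restr_to_subalg (K x) (coord_sigma E {0..int n})) \<in> E \<rightarrow>\<^sub>M prob_algebra (coord_sigma E {0..int n})"
proof (induction n)
  have sub: "subalgebra (K x) (coord_sigma E {0..int n})" if "x \<in> space E" for x n
    using past_subset_future[of E "sets E" n] law_atD(2,3)[OF that] by (auto simp: subalgebra_def)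
  have prob: "prob_space (restr_to_subalg (K x) (coord_sigma E {0..int n}))" if "x \<in> space E" for x n
    by (rule prob_space_restr_to_subalg[OF sub[OF that] law_atD(1)[OF that]])
  have st: "sets (restr_to_subalg (K x) (coord_sigma E {0..int n})) = sets (coord_sigma E {0..int n})"
    if "x \<in> space E" for x n
    using sub[OF that] by (rule sets_restr_to_subalg)
  {
    case 0
    let ?G = "{{\<omega> \<in> paths E. \<omega> (0::int) \<in> A} | A. A \<in> sets E}"
    show ?case
    proof (rule measurable_prob_algebra_generated[where \<Omega>="paths E" and G="?G"])
      show "sets (coord_sigma E {0..int 0}) = sigma_sets (paths E) ?G"
        by (simp add: coord_field_def)
      show "Int_stable ?G"
      proof (rule Int_stableI)
        fix X Y assume "X \<in> ?G" "Y \<in> ?G"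
        then obtain A B where "A \<in> sets E" "B \<in> sets E"
          "X = {\<omega> \<in> paths E. \<omega> 0 \<in> A}" "Y = {\<omega> \<in> paths E. \<omega> 0 \<in> B}" by blast
        then show "X \<inter> Y \<in> ?G" by (intro CollectI exI[of _ "A \<inter> B"]) auto
      qed
      fix X assume "X \<in> ?G"
      then obtain B where B: "B \<in> sets E" "X = {\<omega> \<in> paths E. \<omega> 0 \<in> B}" by auto
      have X: "X \<in> coord_field E (sets E) {0..int 0}" using B by (auto intro!: coord_in_field)
      have eq: "emeasure (restr_to_subalg (K x) (coord_sigma E {0..int 0})) X = indicator B x"
        if x: "x \<in> space E" for x
      proof -
        have "emeasure (restr_to_subalg (K x) (coord_sigma E {0..int 0})) X = emeasure (K x) X"
          using X sub[OF x, of 0] by (simp add: emeasure_restr_to_subalg)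
        also have "\<dots> = emeasure (distr (K x) E (\<lambda>\<omega>. \<omega> 0)) B"
          using B law_atD(2)[OF x] measurable_coord_law[OF law_atD(3)[OF x], of 0]
          by (auto simp: emeasure_distr intro!: arg_cong2[where f=emeasure])
        also have "\<dots> = indicator B x" using law_atD(4)[OF x] B by simp
        finally show ?thesis .
      qed
      show "(\<lambda>x. emeasure (restr_to_subalg (K x) (coord_sigma E {0..int 0})) X) \<in> borel_measurable E"
        using borel_measurable_indicator[OF B(1)] by (subst measurable_cong[OF eq]) auto
    qed (use prob[of _ 0] st[of _ 0] in auto)
  next
    case (Suc n)
    let ?G = "{A \<inter> {\<omega> \<in> paths E. \<omega> (int n + 1) \<in> B} | A B. A \<in> coord_field E (sets E) {0..int n} \<and> B \<in> sets E}"
    let ?F = "coord_sigma E {0..int n}"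
    show ?case
    proof (rule measurable_prob_algebra_generated[where \<Omega>="paths E" and G="?G"])
      show "sets (coord_sigma E {0..int (Suc n)}) = sigma_sets (paths E) ?G"
        unfolding sets_coord_sigma by (rule coord_field_Suc)
      show "Int_stable ?G" "?G \<subseteq> Pow (paths E)" by (rule coord_field_Suc)+
      fix X assume XG: "X \<in> ?G"
      then have XF: "X \<in> coord_field E (sets E) {0..int (Suc n)}" unfolding coord_field_Suc by auto
      obtain A B where B: "B \<in> sets E" and A: "A \<in> coord_field E (sets E) {0..int n}"
        and X: "X = A \<inter> {\<omega> \<in> paths E. \<omega> (int n + 1) \<in> B}" using XG by blast
      let ?f = "\<lambda>\<omega>. emeasure (P (\<omega> (int n))) B * indicator A \<omega>"
      have f: "?f \<in> borel_measurable ?F"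
        using A measurable_compose[OF measurable_coord[of "int n" "{0..int n}" E] measurable_P_emeasure[OF B]]
        by (auto intro!: borel_measurable_times_ennreal borel_measurable_indicator)
      have eq: "emeasure (restr_to_subalg (K x) (coord_sigma E {0..int (Suc n)})) X
          = (\<integral>\<^sup>+ \<omega>. ?f \<omega> \<partial>restr_to_subalg (K x) ?F)" if x: "x \<in> space E" for x
      proof -
        have "emeasure (restr_to_subalg (K x) (coord_sigma E {0..int (Suc n)})) X = emeasure (K x) X"
          using XF sub[OF x, of "Suc n"] by (simp add: emeasure_restr_to_subalg del: of_nat_Suc)
        also have "\<dots> = (\<integral>\<^sup>+ \<omega>. ?f \<omega> \<partial>K x)"
          unfolding X by (rule law_atD(5)[OF x A B])
        also have "\<dots> = (\<integral>\<^sup>+ \<omega>. ?f \<omega> \<partial>restr_to_subalg (K x) ?F)"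
          by (rule nn_integral_subalgebra2[OF sub[OF x] f, symmetric])
        finally show ?thesis .
      qed
      have "(\<lambda>x. \<integral>\<^sup>+ \<omega>. ?f \<omega> \<partial>restr_to_subalg (K x) ?F) \<in> borel_measurable E"
        by (rule measurable_compose[OF measurable_prob_algebraD[OF Suc.IH]
              nn_integral_measurable_subprob_algebra[OF f]])
      then show "(\<lambda>x. emeasure (restr_to_subalg (K x) (coord_sigma E {0..int (Suc n)})) X) \<in> borel_measurable E"
        by (subst measurable_cong[OF eq])
    qed (use prob[of _ "Suc n"] st[of _ "Suc n"] in \<open>auto simp del: of_nat_Suc\<close>)
  }
qed

lemma measurable_law_at: "K \<in> E \<rightarrow>\<^sub>M prob_algebra S"
proof (rule measurable_prob_algebra_generated[where \<Omega>="paths E" and G="\<Union>n. coord_field E (sets E) {0..int n}"])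
  interpret U: algebra "paths E" "\<Union>n. coord_field E (sets E) {0..int n}" by (rule coord_field_cylinders)
  show "sets S = sigma_sets (paths E) (\<Union>n. coord_field E (sets E) {0..int n})"
    unfolding sets_coord_sigma by (rule coord_field_cylinders)
  show "Int_stable (\<Union>n. coord_field E (sets E) {0..int n})" by (rule Int_stableI) (rule U.Int)
  show "(\<Union>n. coord_field E (sets E) {0..int n}) \<subseteq> Pow (paths E)" by (rule U.space_closed)
  fix A assume "A \<in> (\<Union>n. coord_field E (sets E) {0..int n})"
  then obtain n where A: "A \<in> coord_field E (sets E) {0..int n}" by auto
  have "(\<lambda>x. emeasure (restr_to_subalg (K x) (coord_sigma E {0..int n})) A) \<in> borel_measurable E"
    using A by (intro measurable_emeasure_kernel[OF measurable_prob_algebraD[OF measurable_law_at_past]]) simp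
  moreover have "emeasure (restr_to_subalg (K x) (coord_sigma E {0..int n})) A = emeasure (K x) A"
    if "x \<in> space E" for x
    using A past_subset_future[of E "sets E" n] law_atD(2,3)[OF that]
    by (intro emeasure_restr_to_subalg) (auto simp: subalgebra_def)
  ultimately show "(\<lambda>x. emeasure (K x) A) \<in> borel_measurable E" by (simp cong: measurable_cong)
qed (use law_atD in auto)

lemmas measurable_law_at_sub = measurable_prob_algebraD[OF measurable_law_at]

text \<open>The mixture of the laws \<open>K x\<close> inherits the initial law and the Markov property, both of which are
  linear in the law; uniqueness identifies it.\<close>

lemma law_eq_bind:
  assumes \<mu>: "\<mu> \<in> space (prob_algebra E)"
  shows "Q \<mu> = \<mu> \<bind> K"
proof (rule is_markov_law_unique[OF kernel law_is_markov[OF \<mu>]])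
  have s\<mu>: "sets \<mu> = sets E" using \<mu> by (simp add: space_prob_algebra)
  have sp\<mu>: "space \<mu> = space E" by (rule sets_eq_imp_space_eq[OF s\<mu>])
  have K\<mu>: "K \<in> \<mu> \<rightarrow>\<^sub>M prob_algebra S" using measurable_law_at by (simp add: measurable_cong_sets[OF s\<mu> refl])
  note Ks = measurable_prob_algebraD[OF K\<mu>]
  have ss: "sets (\<mu> \<bind> K) = sets S"
    by (rule sets_bind'[OF \<mu> measurable_law_at])
  have em: "emeasure (\<mu> \<bind> K) X = (\<integral>\<^sup>+ x. emeasure (K x) X \<partial>\<mu>)" if "X \<in> sets S" for X
    by (rule emeasure_bind_prob_algebra[OF \<mu> measurable_law_at that])
  show "is_markov_law E P \<mu> (\<mu> \<bind> K)"
    unfolding is_markov_law_def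
  proof (intro conjI allI ballI)
    show "prob_space (\<mu> \<bind> K)" by (rule prob_space_bind'[OF \<mu> measurable_law_at])
    show "space (\<mu> \<bind> K) = paths E" using sets_eq_imp_space_eq[OF ss] by simp
    show "sets (\<mu> \<bind> K) = coord_field E (sets E) {0..}" using ss by simp
    show "distr (\<mu> \<bind> K) E (\<lambda>\<omega>. \<omega> 0) = \<mu>"
    proof (rule measure_eqI)
      fix B assume "B \<in> sets (distr (\<mu> \<bind> K) E (\<lambda>\<omega>. \<omega> 0))"
      then have B: "B \<in> sets E" by simp
      let ?X = "{\<omega> \<in> paths E. \<omega> 0 \<in> B}"
      have X: "?X \<in> sets S" using B by (auto intro!: coord_in_field)
      have v: "(\<lambda>\<omega>. \<omega> 0) -` B \<inter> paths E = ?X" by auto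
      have "emeasure (distr (\<mu> \<bind> K) E (\<lambda>\<omega>. \<omega> 0)) B = emeasure (\<mu> \<bind> K) ?X"
        using B measurable_coord_law[OF ss, of 0] sets_eq_imp_space_eq[OF ss] by (simp add: emeasure_distr v)
      also have "\<dots> = (\<integral>\<^sup>+ x. emeasure (K x) ?X \<partial>\<mu>)" by (rule em[OF X])
      also have "\<dots> = (\<integral>\<^sup>+ x. indicator B x \<partial>\<mu>)"
      proof (rule nn_integral_cong)
        fix x assume "x \<in> space \<mu>"
        then have x: "x \<in> space E" using sp\<mu> by simp
        have "emeasure (K x) ?X = emeasure (distr (K x) E (\<lambda>\<omega>. \<omega> 0)) B"
          using B measurable_coord_law[OF law_atD(3)[OF x], of 0] law_atD(2)[OF x] by (simp add: emeasure_distr v)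
        then show "emeasure (K x) ?X = indicator B x" using law_atD(4)[OF x] B by simp
      qed
      also have "\<dots> = emeasure \<mu> B" using B s\<mu> by simp
      finally show "emeasure (distr (\<mu> \<bind> K) E (\<lambda>\<omega>. \<omega> 0)) B = emeasure \<mu> B" .
    qed (simp add: s\<mu>)
    fix n :: nat and A B assume A: "A \<in> coord_field E (sets E) {0..int n}" and B: "B \<in> sets E"
    have AS: "A \<in> sets S" using A past_subset_future by auto
    let ?f = "\<lambda>\<omega>. emeasure (P (\<omega> (int n))) B * indicator A \<omega>"
    have f: "?f \<in> borel_measurable S"
      using AS measurable_compose[OF measurable_coord[of "int n" "{0..}" E] measurable_P_emeasure[OF B]]
      by (auto intro!: borel_measurable_times_ennreal borel_measurable_indicator)
    have "emeasure (\<mu> \<bind> K) (A \<inter> {\<omega> \<in> paths E. \<omega> (int n + 1) \<in> B}) =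
        (\<integral>\<^sup>+ x. emeasure (K x) (A \<inter> {\<omega> \<in> paths E. \<omega> (int n + 1) \<in> B}) \<partial>\<mu>)"
      using AS B coord_in_field[of "int n + 1" "{0..}" B "sets E" E]
        sets.Int[of A S "{\<omega> \<in> paths E. \<omega> (int n + 1) \<in> B}"] by (intro em) auto
    also have "\<dots> = (\<integral>\<^sup>+ x. (\<integral>\<^sup>+ \<omega>. ?f \<omega> \<partial>K x) \<partial>\<mu>)"
      by (intro nn_integral_cong law_atD(5)[OF _ A B]) (simp add: sp\<mu>)
    also have "\<dots> = (\<integral>\<^sup>+ \<omega>. ?f \<omega> \<partial>(\<mu> \<bind> K))" by (rule nn_integral_bind[OF f Ks, symmetric])
    finally show "emeasure (\<mu> \<bind> K) (A \<inter> {\<omega> \<in> paths E. \<omega> (int n + 1) \<in> B}) =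
        (\<integral>\<^sup>+ \<omega>. ?f \<omega> \<partial>(\<mu> \<bind> K))" .
  qed
qed

lemma emeasure_law:
  assumes "\<mu> \<in> space (prob_algebra E)" "A \<in> sets S"
  shows "emeasure (Q \<mu>) A = (\<integral>\<^sup>+ x. emeasure (K x) A \<partial>\<mu>)"
  unfolding law_eq_bind[OF assms(1)] by (rule emeasure_bind_prob_algebra[OF assms(1) measurable_law_at assms(2)])

text \<open>Given an event of the past up to time \<open>n\<close>, the future after \<open>n\<close> is again a Markov chain with the
  same kernel. This is the one-step property at time \<open>n + m\<close>, applied to the events that combine
  \<open>C\<close> with a condition on the coordinates \<open>n, \<dots>, n + m\<close>.\<close>

lemma conditioned_shifted_law:
  assumes \<mu>: "\<mu> \<in> space (prob_algebra E)" and C: "C \<in> coord_field E (sets E) {0..int n}"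
    and pos: "emeasure (Q \<mu>) C \<noteq> 0"
  defines "U \<equiv> uniform_measure (Q \<mu>) C"
  shows "is_markov_law E P (distr U E (\<lambda>\<omega>. \<omega> (int n))) (distr U S (path_shift (int n)))"
proof -
  interpret Q: prob_space "Q \<mu>" by (rule lawD(1)[OF \<mu>])
  have sQ: "sets (Q \<mu>) = sets S" by (rule lawD(3)[OF \<mu>])
  have spQ: "space (Q \<mu>) = paths E" by (rule lawD(2)[OF \<mu>])
  have CQ: "C \<in> sets (Q \<mu>)" using C past_subset_future sQ by auto
  have fin: "emeasure (Q \<mu>) C \<noteq> \<infinity>" by simp
  interpret U: prob_space U unfolding U_def by (rule prob_space_uniform_measure[OF pos fin])
  have sU: "sets U = sets S" "space U = paths E" unfolding U_def using sQ spQ by auto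
  have sh: "path_shift (int n) \<in> U \<rightarrow>\<^sub>M S"
    using measurable_shift[of "{0..}" "int n" "{0..}" E] by (simp add: measurable_cong_sets[OF sU(1) refl])
  show ?thesis
    unfolding is_markov_law_def
  proof (intro conjI allI ballI)
    show "prob_space (distr U S (path_shift (int n)))" by (rule U.prob_space_distr[OF sh])
    show "distr (distr U S (path_shift (int n))) E (\<lambda>\<omega>. \<omega> 0) = distr U E (\<lambda>\<omega>. \<omega> (int n))"
      by (subst distr_distr[OF measurable_coord sh]) (auto simp: comp_def path_shift_apply)
    fix m :: nat and A B assume A: "A \<in> coord_field E (sets E) {0..int m}" and B: "B \<in> sets E"
    have AS: "A \<in> sets S" using A past_subset_future by auto
    have BS: "{\<omega> \<in> paths E. \<omega> (int m + 1) \<in> B} \<in> sets S"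
      using B by (simp add: coord_in_field)
    let ?D = "{\<omega> \<in> paths E. path_shift (int n) \<omega> \<in> A}"
    have D: "?D \<in> coord_field E (sets E) {0..int (n + m)}"
      by (rule shift_vimage_coord_field[OF A]) auto
    have "C \<in> coord_field E (sets E) {0..int (n + m)}"
      using C coord_field_mono[of "{0..int n}" "{0..int (n + m)}"] by auto
    then have CD: "C \<inter> ?D \<in> coord_field E (sets E) {0..int (n + m)}"
      using D sets.Int[of C "coord_sigma E {0..int (n + m)}" ?D] by auto
    have DQ: "?D \<in> sets (Q \<mu>)" using D past_subset_future[of E "sets E" "n + m"] sQ by auto
    let ?Y = "{\<omega> \<in> paths E. \<omega> (int (n + m) + 1) \<in> B}"
    have YQ: "?Y \<in> sets (Q \<mu>)" using B sQ by (simp add: coord_in_field)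
    let ?f = "\<lambda>\<omega>. emeasure (P (\<omega> (int m))) B * indicator A \<omega>"
    have f: "?f \<in> borel_measurable S"
      using AS measurable_compose[OF measurable_coord[of "int m" "{0..}" E] measurable_P_emeasure[OF B]]
      by (auto intro!: borel_measurable_times_ennreal borel_measurable_indicator)
    have fs: "(\<lambda>\<omega>. ?f (path_shift (int n) \<omega>)) \<in> borel_measurable (Q \<mu>)"
      using measurable_compose[OF sh f] by (simp add: U_def)
    have "emeasure (distr U S (path_shift (int n))) (A \<inter> {\<omega> \<in> paths E. \<omega> (int m + 1) \<in> B}) = emeasure U (?D \<inter> ?Y)"
    proof (subst emeasure_distr[OF sh])
      show "A \<inter> {\<omega> \<in> paths E. \<omega> (int m + 1) \<in> B} \<in> sets S" using AS BS by (rule sets.Int)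
      show "emeasure U (path_shift (int n) -` (A \<inter> {\<omega> \<in> paths E. \<omega> (int m + 1) \<in> B}) \<inter> space U) = emeasure U (?D \<inter> ?Y)"
        by (intro arg_cong2[where f=emeasure]) (auto simp: sU path_shift_apply add_ac)
    qed
    also have "\<dots> = emeasure (Q \<mu>) ((C \<inter> ?D) \<inter> ?Y) / emeasure (Q \<mu>) C"
      using CQ DQ YQ by (simp add: U_def Int_assoc)
    also have "emeasure (Q \<mu>) ((C \<inter> ?D) \<inter> ?Y)
        = (\<integral>\<^sup>+ \<omega>. emeasure (P (\<omega> (int (n + m)))) B * indicator (C \<inter> ?D) \<omega> \<partial>Q \<mu>)"
      by (rule lawD(5)[OF \<mu> CD B])
    also have "\<dots> = (\<integral>\<^sup>+ \<omega>. ?f (path_shift (int n) \<omega>) * indicator C \<omega> \<partial>Q \<mu>)"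
      by (intro nn_integral_cong) (auto simp: spQ path_shift_apply add_ac split: split_indicator)
    also have "\<dots> / emeasure (Q \<mu>) C = (\<integral>\<^sup>+ \<omega>. ?f (path_shift (int n) \<omega>) \<partial>U)"
      unfolding U_def by (rule nn_integral_uniform_measure[OF fs CQ, symmetric])
    also have "\<dots> = (\<integral>\<^sup>+ \<omega>. ?f \<omega> \<partial>distr U S (path_shift (int n)))"
      by (rule nn_integral_distr_target[OF sh f, symmetric])
    finally show "emeasure (distr U S (path_shift (int n))) (A \<inter> {\<omega> \<in> paths E. \<omega> (int m + 1) \<in> B}) = \<dots>" .
  qed simp_all
qed

text \<open>By uniqueness the conditioned and shifted law is the mixture of the \<open>K x\<close> over the conditional
  law of the coordinate \<open>n\<close>; multiplying by the probability of \<open>C\<close> gives the formula.\<close>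

theorem markov_property:
  assumes \<mu>: "\<mu> \<in> space (prob_algebra E)" and C: "C \<in> coord_field E (sets E) {0..int n}" and A: "A \<in> sets S"
  shows "emeasure (Q \<mu>) (C \<inter> {\<omega> \<in> paths E. path_shift (int n) \<omega> \<in> A})
    = (\<integral>\<^sup>+ \<omega> \<in> C. emeasure (K (\<omega> (int n))) A \<partial>Q \<mu>)"
proof -
  interpret Q: prob_space "Q \<mu>" by (rule lawD(1)[OF \<mu>])
  have sQ: "sets (Q \<mu>) = sets S" by (rule lawD(3)[OF \<mu>])
  have spQ: "space (Q \<mu>) = paths E" by (rule lawD(2)[OF \<mu>])
  have CQ: "C \<in> sets (Q \<mu>)" using C past_subset_future sQ by auto
  let ?D = "{\<omega> \<in> paths E. path_shift (int n) \<omega> \<in> A}"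
  have D: "?D \<in> sets (Q \<mu>)"
    unfolding sQ sets_coord_sigma by (rule shift_vimage_coord_field[of _ _ _ "{0..}"]) (use A in auto)
  have KA: "(\<lambda>x. emeasure (K x) A) \<in> borel_measurable E"
    by (rule measurable_emeasure_kernel[OF measurable_law_at_sub A])
  have Kn: "(\<lambda>\<omega>. emeasure (K (\<omega> (int n))) A) \<in> borel_measurable (Q \<mu>)"
    by (rule measurable_compose[OF measurable_coord_law[OF sQ] KA]) simp
  show ?thesis
  proof (cases "emeasure (Q \<mu>) C = 0")
    case True
    then have "emeasure (Q \<mu>) (C \<inter> ?D) = 0" using CQ D
      by (metis emeasure_mono inf_le1 le_zero_eq)
    moreover have "(\<integral>\<^sup>+ \<omega> \<in> C. emeasure (K (\<omega> (int n))) A \<partial>Q \<mu>) = 0"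
      using True CQ Kn AE_not_in[of C "Q \<mu>"] by (subst nn_integral_0_iff_AE) (auto simp: null_sets_def)
    ultimately show ?thesis by simp
  next
    case False
    define U where "U = uniform_measure (Q \<mu>) C"
    have fin: "emeasure (Q \<mu>) C \<noteq> \<infinity>" by simp
    interpret U: prob_space U unfolding U_def by (rule prob_space_uniform_measure[OF False fin])
    have sU: "sets U = sets S" "space U = paths E" unfolding U_def using sQ spQ by auto
    have sh: "path_shift (int n) \<in> U \<rightarrow>\<^sub>M S"
      using measurable_shift[of "{0..}" "int n" "{0..}" E] by (simp add: measurable_cong_sets[OF sU(1) refl])
    have Xn: "(\<lambda>\<omega>. \<omega> (int n)) \<in> U \<rightarrow>\<^sub>M E" by (rule measurable_coord_law[OF sU(1)]) simp
    let ?\<nu> = "distr U E (\<lambda>\<omega>. \<omega> (int n))"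
    have \<nu>: "?\<nu> \<in> space (prob_algebra E)"
      by (simp add: space_prob_algebra U.prob_space_distr[OF Xn])
    have eq: "distr U S (path_shift (int n)) = Q ?\<nu>"
      using is_markov_law_unique[OF kernel conditioned_shifted_law[OF \<mu> C False] law_is_markov]
        \<nu> unfolding U_def by blast
    have "emeasure (Q \<mu>) (C \<inter> ?D) / emeasure (Q \<mu>) C = emeasure U ?D"
      unfolding U_def using CQ D by simp
    also have "\<dots> = emeasure (distr U S (path_shift (int n))) A"
      using A by (simp add: emeasure_distr[OF sh] sU vimage_def Int_def conj_commute)
    also have "\<dots> = (\<integral>\<^sup>+ x. emeasure (K x) A \<partial>?\<nu>)" unfolding eq by (rule emeasure_law[OF \<nu> A])
    also have "\<dots> = (\<integral>\<^sup>+ \<omega>. emeasure (K (\<omega> (int n))) A \<partial>U)"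
      by (rule nn_integral_distr_target[OF Xn KA])
    also have "\<dots> = (\<integral>\<^sup>+ \<omega> \<in> C. emeasure (K (\<omega> (int n))) A \<partial>Q \<mu>) / emeasure (Q \<mu>) C"
      unfolding U_def by (rule nn_integral_uniform_measure[OF Kn CQ])
    finally have eq_div: "emeasure (Q \<mu>) C * (emeasure (Q \<mu>) (C \<inter> ?D) / emeasure (Q \<mu>) C)
        = emeasure (Q \<mu>) C * ((\<integral>\<^sup>+ \<omega> \<in> C. emeasure (K (\<omega> (int n))) A \<partial>Q \<mu>) / emeasure (Q \<mu>) C)"
      by (rule arg_cong)
    have cancel: "emeasure (Q \<mu>) C * (b / emeasure (Q \<mu>) C) = b" for b
      using False fin by (simp add: ennreal_times_divide mult.commute[of "emeasure (Q \<mu>) C"] ennreal_mult_divide_eq)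
    show ?thesis using eq_div unfolding cancel .
  qed
qed

end

section \<open>Bounded integrals and product null sets\<close>

lemma (in prob_space) integrable_bounded_1:
  fixes f :: "'a \<Rightarrow> real"
  assumes "f \<in> borel_measurable M" "\<And>x. x \<in> space M \<Longrightarrow> \<bar>f x\<bar> \<le> 1"
  shows "integrable M f"
  using assms by (intro integrable_const_bound[of _ 1]) auto

lemma (in prob_space) integral_tendsto_0:
  fixes f :: "nat \<Rightarrow> 'a \<Rightarrow> real"
  assumes m: "\<And>n. f n \<in> borel_measurable M" and lim: "AE x in M. (\<lambda>n. f n x) \<longlonglongrightarrow> 0"
    and bd: "\<And>n x. x \<in> space M \<Longrightarrow> \<bar>f n x\<bar> \<le> 1"
  shows "(\<lambda>n. \<integral>x. f n x \<partial>M) \<longlonglongrightarrow> 0"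
proof -
  have "(\<lambda>n. \<integral>x. f n x \<partial>M) \<longlonglongrightarrow> (\<integral>x. 0 \<partial>M)"
    by (rule integral_dominated_convergence[where w="\<lambda>_. 1"]) (use m lim bd in auto)
  then show ?thesis by simp
qed

text \<open>The property need not define a measurable set, so the proof passes through a null set that covers
  its failures.\<close>

lemma AE_pair_measure_both:
  assumes M: "prob_space M" and R: "AE x in M. R x"
  shows "AE (x, y) in M \<Otimes>\<^sub>M M. R x \<and> R y"
proof -
  interpret M: prob_space M by fact
  interpret pair_prob_space M M by standard
  obtain N where N: "N \<in> null_sets M" "{x \<in> space M. \<not> R x} \<subseteq> N" using R by (auto elim!: AE_E intro: that)
  have Ns: "N \<in> sets M" using N by auto
  have "AE x in M. x \<notin> N" by (rule AE_not_in[OF N(1)])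
  then have "AE x in M. AE y in M. x \<notin> N \<and> y \<notin> N" using AE_not_in[OF N(1)] by auto
  then have "AE z in M \<Otimes>\<^sub>M M. fst z \<notin> N \<and> snd z \<notin> N"
    by (intro AE_pair_measure) (use Ns in measurable)
  with AE_space show ?thesis by eventually_elim (use N in \<open>auto simp: space_pair_measure\<close>)
qed

section \<open>The local tail field of a stationary chain\<close>

locale local_chain = markov_kernel E P for E :: "'a measure" and P +
  fixes \<E>0 :: "'a set set" and lam :: "'a measure"
  assumes sub: "\<E>0 \<subseteq> sets E"
    and cg: "countably_generated (space E) \<E>0"
    and lam: "lam \<in> space (prob_algebra E)"
    and inv: "lam \<bind> P = lam"
begin

abbreviation "F \<equiv> local_future E \<E>0"
abbreviation "T \<equiv> local_tail E \<E>0"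

sublocale lam: prob_space lam using lam by (simp add: space_prob_algebra)

lemma sets_lam: "sets lam = sets E" using lam by (simp add: space_prob_algebra)
lemma space_lam: "space lam = space E" by (rule sets_eq_imp_space_eq[OF sets_lam])

lemma measurable_lam: "f \<in> borel_measurable E \<Longrightarrow> f \<in> borel_measurable lam"
  by (simp add: measurable_cong_sets[OF sets_lam refl])

sublocale Ql: prob_space "Q lam" by (rule lawD(1)[OF lam])

lemma sigma_algebra_future: "sigma_algebra (paths E) (F n)"
  unfolding local_future_def by (rule sigma_algebra_coord_field)

lemma future_sub: "F n \<subseteq> sets S"
  using coord_field_mono_field[OF sub, of E "{int n..}"] coord_field_mono[of "{int n..}" "{0..}" E "sets E"]
  by (auto simp: local_future_def)

lemma future_dec: "F (Suc n) \<subseteq> F n"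
  unfolding local_future_def by (rule coord_field_mono) auto

lemma tail_sub: "A \<in> T \<Longrightarrow> A \<in> sets S" using future_sub by (auto simp: local_tail_def)

lemma space_in_tail: "paths E \<in> T"
  unfolding local_tail_def
proof
  fix n
  interpret F: sigma_algebra "paths E" "F n" by (rule sigma_algebra_future)
  show "paths E \<in> F n" by (rule F.top)
qed

lemma tv_tail:
  assumes R: "prob_space R" "sets R = sets S" and R': "prob_space R'" "sets R' = sets S"
  obtains A where "A \<in> T" "tv_on T R R' = 2 * (measure R A - measure R' A)"
    "(\<lambda>n. tv_on (F n) R R') \<longlonglongrightarrow> tv_on T R R'"
proof -
  have sp: "space R = paths E" using sets_eq_imp_space_eq[OF R(2)] by simp
  obtain A where "A \<in> (\<Inter>n. F n)" "tv_on (\<Inter>n. F n) R R' = 2 * (measure R A - measure R' A)"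
      "(\<lambda>n. tv_on (F n) R R') \<longlonglongrightarrow> 2 * (measure R A - measure R' A)"
  proof (rule tv_on_tail[OF R(1) R'(1), of F])
    show "sigma_algebra (space R) (F n)" for n unfolding sp by (rule sigma_algebra_future)
    show "F n \<subseteq> sets R" for n unfolding R(2) by (rule future_sub)
    show "sets R = sets R'" by (simp add: R R')
    show "F (Suc n) \<subseteq> F n" for n by (rule future_dec)
  qed
  then show thesis using that[of A] unfolding local_tail_def by simp
qed

text \<open>With its analogue below for strict upper bounds, this moves each condition on the futures
  \<open>F n\<close> to a condition on the tail field alone.\<close>

lemma tv_future_tendsto_0_iff:
  assumes R: "prob_space R" "sets R = sets S" and R': "prob_space R'" "sets R' = sets S"
  shows "(\<lambda>n. tv_on (F n) R R') \<longlonglongrightarrow> 0 \<longleftrightarrow> tv_on T R R' = 0"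
proof -
  obtain A where "(\<lambda>n. tv_on (F n) R R') \<longlonglongrightarrow> tv_on T R R'" by (rule tv_tail[OF assms])
  then show ?thesis using LIMSEQ_unique by auto
qed

lemma tv_future_less_iff:
  assumes R: "prob_space R" "sets R = sets S" and R': "prob_space R'" "sets R' = sets S"
  shows "(\<exists>n. tv_on (F n) R R' < c) \<longleftrightarrow> tv_on T R R' < c"
proof
  assume "\<exists>n. tv_on (F n) R R' < c"
  then obtain n where n: "tv_on (F n) R R' < c" by blast
  have "tv_on T R R' \<le> tv_on (F n) R R'"
    using space_in_tail by (intro tv_on_mono[OF R(1) R'(1)]) (auto simp: local_tail_def)
  then show "tv_on T R R' < c" using n by simp
next
  assume c: "tv_on T R R' < c"
  obtain A where "(\<lambda>n. tv_on (F n) R R') \<longlonglongrightarrow> tv_on T R R'" by (rule tv_tail[OF assms])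
  from order_tendstoD(2)[OF this c] show "\<exists>n. tv_on (F n) R R' < c"
    by (auto simp: eventually_sequentially)
qed

lemma tv_tail_eq_0_iff:
  assumes R: "prob_space R" "prob_space R'"
  shows "tv_on T R R' = 0 \<longleftrightarrow> (\<forall>A\<in>T. measure R A = measure R' A)"
proof
  assume "tv_on T R R' = 0"
  then show "\<forall>A\<in>T. measure R A = measure R' A" using tv_on_upper[OF R, of _ T] by auto
next
  assume eq: "\<forall>A\<in>T. measure R A = measure R' A"
  have "T \<noteq> {}" using space_in_tail by blast
  moreover from this have "tv_on T R R' \<le> 2 * 0" by (rule tv_on_least) (simp add: eq)
  ultimately show "tv_on T R R' = 0" using tv_on_nonneg[OF R, of T] by simp
qed

text \<open>The event \<open>A\<close> as seen by a chain whose time zero is time \<open>n\<close>. On the two-sided path space the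
  shift is a bijection, so every tail event has such a form, and it is again a tail event.\<close>

definition unshift :: "nat \<Rightarrow> (int \<Rightarrow> 'a) set \<Rightarrow> (int \<Rightarrow> 'a) set" where
  "unshift n A = {\<omega> \<in> paths E. path_shift (- int n) \<omega> \<in> A}"

lemma unshift_tail:
  assumes A: "A \<in> T" shows "unshift n A \<in> T"
  unfolding local_tail_def
proof
  fix m
  have "A \<in> coord_field E \<E>0 {int (m + n)..}" using A unfolding local_tail_def local_future_def by blast
  then show "unshift n A \<in> F m"
    unfolding unshift_def local_future_def by (rule shift_vimage_coord_field) auto
qed

lemma shift_unshift:
  assumes A: "A \<in> T" shows "{\<omega> \<in> paths E. path_shift (int n) \<omega> \<in> unshift n A} = A"
proof -
  have "A \<subseteq> paths E" using sets.sets_into_space[OF tail_sub[OF A]] by simp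
  moreover have "path_shift (- int n) (path_shift (int n) \<omega>) = \<omega>" for \<omega> :: "int \<Rightarrow> 'a"
    by (simp add: path_shift_def)
  ultimately show ?thesis by (auto simp: unshift_def)
qed

text \<open>By the Markov property, \<open>tail_prob n A\<close> evaluated at the coordinate \<open>n\<close> is the conditional
  probability of \<open>A\<close> given the past up to time \<open>n\<close>, whatever the initial law.\<close>

definition tail_prob :: "nat \<Rightarrow> (int \<Rightarrow> 'a) set \<Rightarrow> 'a \<Rightarrow> real" where
  "tail_prob n A x = measure (K x) (unshift n A)"

lemma tail_prob_nonneg: "0 \<le> tail_prob n A x" by (simp add: tail_prob_def)

lemma tail_prob_le_1: "x \<in> space E \<Longrightarrow> tail_prob n A x \<le> 1"
  unfolding tail_prob_def by (rule prob_space.prob_le_1[OF law_atD(1)])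

lemma measurable_measure_law_at: "A \<in> sets S \<Longrightarrow> (\<lambda>x. measure (K x) A) \<in> borel_measurable E"
  by (rule measurable_compose[OF measurable_law_at_sub measurable_measure_subprob_algebra])

lemma measurable_tail_prob: "A \<in> T \<Longrightarrow> tail_prob n A \<in> borel_measurable E"
  unfolding tail_prob_def by (intro measurable_measure_law_at tail_sub unshift_tail)

lemma measurable_compose_coord:
  assumes "\<mu> \<in> space (prob_algebra E)" "f \<in> borel_measurable E"
  shows "(\<lambda>\<omega>. f (\<omega> (int n))) \<in> borel_measurable (Q \<mu>)"
  by (rule measurable_compose[OF measurable_coord_law[OF lawD(3)[OF assms(1)]] assms(2)]) simp

lemma tail_prob_coord_bounds:
  assumes "\<mu> \<in> space (prob_algebra E)" "\<omega> \<in> space (Q \<mu>)"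
  shows "0 \<le> tail_prob n A (\<omega> (int n))" "tail_prob n A (\<omega> (int n)) \<le> 1"
  using assms lawD(2)[OF assms(1)] by (auto intro: tail_prob_nonneg tail_prob_le_1 simp: paths_iff)

lemma measure_past_Int_tail:
  assumes \<mu>: "\<mu> \<in> space (prob_algebra E)" and C: "C \<in> coord_field E (sets E) {0..int n}" and A: "A \<in> T"
  shows "measure (Q \<mu>) (C \<inter> A) = (\<integral>\<omega>. tail_prob n A (\<omega> (int n)) * indicator C \<omega> \<partial>Q \<mu>)"
proof -
  interpret Q: prob_space "Q \<mu>" by (rule lawD(1)[OF \<mu>])
  let ?f = "\<lambda>\<omega>. tail_prob n A (\<omega> (int n)) * indicator C \<omega>"
  have CQ: "C \<in> sets (Q \<mu>)" using C past_subset_future lawD(3)[OF \<mu>] by auto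
  note b = tail_prob_coord_bounds[OF \<mu>]
  have f: "?f \<in> borel_measurable (Q \<mu>)"
    by (intro borel_measurable_times measurable_compose_coord[OF \<mu>] measurable_tail_prob A borel_measurable_indicator CQ)
  have int: "integrable (Q \<mu>) ?f"
    by (rule Q.integrable_bounded_1[OF f]) (use b in \<open>auto simp: indicator_def\<close>)
  have "emeasure (Q \<mu>) (C \<inter> A) = (\<integral>\<^sup>+ \<omega> \<in> C. emeasure (K (\<omega> (int n))) (unshift n A) \<partial>Q \<mu>)"
    using markov_property[OF \<mu> C tail_sub[OF unshift_tail[OF A]], of n] unfolding shift_unshift[OF A] .
  also have "\<dots> = (\<integral>\<^sup>+ \<omega>. ennreal (?f \<omega>) \<partial>Q \<mu>)"
  proof (rule nn_integral_cong)
    fix \<omega> assume "\<omega> \<in> space (Q \<mu>)"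
    then have "\<omega> (int n) \<in> space E" using lawD(2)[OF \<mu>] by (simp add: paths_iff)
    then interpret K: prob_space "K (\<omega> (int n))" by (rule law_atD(1))
    show "emeasure (K (\<omega> (int n))) (unshift n A) * indicator C \<omega> = ennreal (?f \<omega>)"
      by (simp add: tail_prob_def K.emeasure_eq_measure indicator_def)
  qed
  also have "\<dots> = ennreal (\<integral>\<omega>. ?f \<omega> \<partial>Q \<mu>)"
    by (rule nn_integral_eq_integral[OF int]) (auto simp: tail_prob_nonneg)
  finally show ?thesis
    by (simp add: Q.emeasure_eq_measure tail_prob_nonneg)
qed

lemma measure_tail:
  assumes \<mu>: "\<mu> \<in> space (prob_algebra E)" and A: "A \<in> T"
  shows "measure (Q \<mu>) A = (\<integral>\<omega>. tail_prob n A (\<omega> (int n)) \<partial>Q \<mu>)"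
proof -
  have AP: "A \<subseteq> paths E" using sets.sets_into_space[OF tail_sub[OF A]] by simp
  have "paths E \<in> coord_field E (sets E) {0..int n}"
    using sets.top[of "coord_sigma E {0..int n}"] by simp
  from measure_past_Int_tail[OF \<mu> this A]
  have "measure (Q \<mu>) A = (\<integral>\<omega>. tail_prob n A (\<omega> (int n)) * indicator (paths E) \<omega> \<partial>Q \<mu>)"
    using AP by (simp add: Int_absorb1)
  also have "\<dots> = (\<integral>\<omega>. tail_prob n A (\<omega> (int n)) \<partial>Q \<mu>)"
    by (intro Bochner_Integration.integral_cong) (auto simp: lawD(2)[OF \<mu>])
  finally show ?thesis .
qed

text \<open>A weak form of Levy's zero-one law, with an elementary proof. The integral is the mean
  squared distance from \<open>indicator A\<close> to its conditional expectation given the past. It is thus at most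
  the mean squared distance to \<open>indicator C\<close> for any event \<open>C\<close> of that past, which is the probability
  of the symmetric difference of \<open>A\<close> and \<open>C\<close>; and \<open>A\<close> can be approximated by events of finite horizon.\<close>

lemma tail_prob_variance_tendsto_0:
  assumes \<mu>: "\<mu> \<in> space (prob_algebra E)" and A: "A \<in> T"
  shows "(\<lambda>n. \<integral>\<omega>. tail_prob n A (\<omega> (int n)) * (1 - tail_prob n A (\<omega> (int n))) \<partial>Q \<mu>) \<longlonglongrightarrow> 0"
proof (rule LIMSEQ_I)
  fix e :: real assume e: "0 < e"
  interpret Q: prob_space "Q \<mu>" by (rule lawD(1)[OF \<mu>])
  note b = tail_prob_coord_bounds[OF \<mu>]
  have sQ: "sets (Q \<mu>) = sets S" by (rule lawD(3)[OF \<mu>])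
  have AQ: "A \<in> sets (Q \<mu>)" using tail_sub[OF A] sQ by simp
  have "\<exists>C\<in>\<Union>n. coord_field E (sets E) {0..int n}. measure (Q \<mu>) (sym_diff A C) < e \<and> measure (Q \<mu>) (sym_diff A C) < e"
    by (rule sigma_sets_approx_algebra[OF Q.finite_measure_axioms Q.finite_measure_axioms refl coord_field_cylinders(1) _ AQ e])
      (simp add: sQ coord_field_cylinders(2)[symmetric])
  then obtain C m where C: "C \<in> coord_field E (sets E) {0..int m}" and Ce: "measure (Q \<mu>) (sym_diff A C) < e"
    by auto
  have CQ: "C \<in> sets (Q \<mu>)" using C past_subset_future sQ by auto
  show "\<exists>m. \<forall>n\<ge>m. norm ((\<integral>\<omega>. tail_prob n A (\<omega> (int n)) * (1 - tail_prob n A (\<omega> (int n))) \<partial>Q \<mu>) - 0) < e"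
  proof (intro exI[of _ m] allI impI)
    fix n assume "m \<le> n"
    then have Cn: "C \<in> coord_field E (sets E) {0..int n}"
      using C coord_field_mono[of "{0..int m}" "{0..int n}"] by auto
    define f where "f \<omega> = tail_prob n A (\<omega> (int n))" for \<omega> :: "int \<Rightarrow> 'a"
    have [measurable]: "f \<in> borel_measurable (Q \<mu>)"
      unfolding f_def by (intro measurable_compose_coord[OF \<mu>] measurable_tail_prob A)
    have fb: "0 \<le> f \<omega>" "f \<omega> \<le> 1" if "\<omega> \<in> space (Q \<mu>)" for \<omega> using b[OF that] by (auto simp: f_def)
    note CQ [measurable]
    have int: "integrable (Q \<mu>) f" "integrable (Q \<mu>) (\<lambda>\<omega>. f \<omega> * indicator C \<omega>)"
      "integrable (Q \<mu>) (\<lambda>\<omega>. f \<omega> * (1 - f \<omega>))" "integrable (Q \<mu>) (indicator C :: _ \<Rightarrow> real)"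
      by (rule Q.integrable_bounded_1; use fb in \<open>force simp: indicator_def mult_le_one\<close>)+
    have "(\<integral>\<omega>. f \<omega> * (1 - f \<omega>) \<partial>Q \<mu>) \<le> (\<integral>\<omega>. f \<omega> - 2 * (f \<omega> * indicator C \<omega>) + indicator C \<omega> \<partial>Q \<mu>)"
    proof (rule integral_mono)
      fix \<omega>
      have "0 \<le> (f \<omega> - indicator C \<omega>)\<^sup>2" by simp
      then show "f \<omega> * (1 - f \<omega>) \<le> f \<omega> - 2 * (f \<omega> * indicator C \<omega>) + indicator C \<omega>"
        by (auto simp: indicator_def power2_eq_square algebra_simps)
    qed (use int in auto)
    also have "\<dots> = measure (Q \<mu>) A - 2 * measure (Q \<mu>) (C \<inter> A) + measure (Q \<mu>) C"
      using int CQ measure_tail[OF \<mu> A, of n] measure_past_Int_tail[OF \<mu> Cn A]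
      by (simp add: f_def[symmetric])
    also have "\<dots> = measure (Q \<mu>) (sym_diff A C)"
    proof -
      have "measure (Q \<mu>) (sym_diff A C) = measure (Q \<mu>) (A - C) + measure (Q \<mu>) (C - A)"
        using AQ CQ by (intro Q.finite_measure_Union) auto
      also have "\<dots> = measure (Q \<mu>) A - measure (Q \<mu>) (A \<inter> C) + (measure (Q \<mu>) C - measure (Q \<mu>) (C \<inter> A))"
        using AQ CQ by (simp add: Q.finite_measure_Diff')
      finally show ?thesis by (simp add: Int_commute)
    qed
    finally have "(\<integral>\<omega>. f \<omega> * (1 - f \<omega>) \<partial>Q \<mu>) < e" using Ce by simp
    moreover have "0 \<le> (\<integral>\<omega>. f \<omega> * (1 - f \<omega>) \<partial>Q \<mu>)" using fb by (intro Bochner_Integration.integral_nonneg) auto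
    ultimately show "norm ((\<integral>\<omega>. tail_prob n A (\<omega> (int n)) * (1 - tail_prob n A (\<omega> (int n))) \<partial>Q \<mu>) - 0) < e"
      by (simp add: f_def)
  qed
qed

lemma distr_coord_stationary: "distr (Q lam) E (\<lambda>\<omega>. \<omega> (int n)) = lam"
proof (induction n)
  case 0 then show ?case using lawD(4)[OF lam] by simp
next
  case (Suc n)
  note X = measurable_coord_law[OF lawD(3)[OF lam]]
  show ?case
  proof (rule measure_eqI)
    fix B assume "B \<in> sets (distr (Q lam) E (\<lambda>\<omega>. \<omega> (int (Suc n))))"
    then have B: "B \<in> sets E" by simp
    have Pm: "P \<in> lam \<rightarrow>\<^sub>M subprob_algebra E"
      using measurable_prob_algebraD[OF kernel] by (simp add: measurable_cong_sets[OF sets_lam refl])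
    have top: "paths E \<in> coord_field E (sets E) {0..int n}"
      using sets.top[of "coord_sigma E {0..int n}"] by simp
    have "emeasure (distr (Q lam) E (\<lambda>\<omega>. \<omega> (int (Suc n)))) B
        = emeasure (Q lam) (paths E \<inter> {\<omega> \<in> paths E. \<omega> (int n + 1) \<in> B})"
      using B X[of "int (Suc n)"] lawD(2)[OF lam]
      by (auto simp: emeasure_distr add.commute intro!: arg_cong2[where f=emeasure])
    also have "\<dots> = (\<integral>\<^sup>+ \<omega>. emeasure (P (\<omega> (int n))) B * indicator (paths E) \<omega> \<partial>Q lam)"
      by (rule lawD(5)[OF lam top B])
    also have "\<dots> = (\<integral>\<^sup>+ \<omega>. emeasure (P (\<omega> (int n))) B \<partial>Q lam)"
      by (intro nn_integral_cong) (simp add: lawD(2)[OF lam])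
    also have "\<dots> = (\<integral>\<^sup>+ x. emeasure (P x) B \<partial>distr (Q lam) E (\<lambda>\<omega>. \<omega> (int n)))"
      by (rule nn_integral_distr_target[symmetric, OF X measurable_P_emeasure[OF B]]) simp
    also have "\<dots> = emeasure (lam \<bind> P) B"
      unfolding Suc.IH by (rule emeasure_bind[OF lam.not_empty Pm B, symmetric])
    finally show "emeasure (distr (Q lam) E (\<lambda>\<omega>. \<omega> (int (Suc n)))) B = emeasure lam B" by (simp add: inv)
  qed (simp add: sets_lam)
qed

lemma integral_coord_stationary:
  assumes "f \<in> borel_measurable E"
  shows "(\<integral>\<omega>. f (\<omega> (int n)) \<partial>Q lam) = (\<integral>x. (f x :: real) \<partial>lam)"
  using integral_distr[OF measurable_coord_law[OF lawD(3)[OF lam], of "int n"] assms]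
  unfolding distr_coord_stationary by simp

lemma measure_stationary:
  assumes A: "A \<in> sets S" shows "measure (Q lam) A = (\<integral>x. measure (K x) A \<partial>lam)"
proof -
  have int: "integrable lam (\<lambda>x. measure (K x) A)"
    using measurable_lam[OF measurable_measure_law_at[OF A]] prob_space.prob_le_1[OF law_atD(1)]
    by (intro lam.integrable_bounded_1) (auto simp: space_lam)
  have "ennreal (measure (Q lam) A) = emeasure (Q lam) A" by (simp add: Ql.emeasure_eq_measure)
  also have "\<dots> = (\<integral>\<^sup>+ x. emeasure (K x) A \<partial>lam)" by (rule emeasure_law[OF lam A])
  also have "\<dots> = (\<integral>\<^sup>+ x. ennreal (measure (K x) A) \<partial>lam)"
    using law_atD(1) by (intro nn_integral_cong finite_measure.emeasure_eq_measure prob_space.finite_measure)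
      (simp add: space_lam)
  also have "\<dots> = ennreal (\<integral>x. measure (K x) A \<partial>lam)" by (rule nn_integral_eq_integral[OF int]) simp
  finally show ?thesis by (simp add: integral_nonneg)
qed

lemma integral_tail_prob:
  assumes "A \<in> T" shows "(\<integral>x. tail_prob n A x \<partial>lam) = measure (Q lam) A"
  using measure_tail[OF lam assms, of n] integral_coord_stationary[OF measurable_tail_prob[OF assms], of n] by simp

lemma measure_unshift: "A \<in> T \<Longrightarrow> measure (Q lam) (unshift n A) = measure (Q lam) A"
  using measure_stationary[OF tail_sub[OF unshift_tail]] integral_tail_prob[of A n] by (simp add: tail_prob_def)

lemma tail_prob_variance_stationary_tendsto_0:
  assumes A: "A \<in> T"
  shows "(\<lambda>n. \<integral>x. tail_prob n A x * (1 - tail_prob n A x) \<partial>lam) \<longlonglongrightarrow> 0"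
proof -
  have "(\<lambda>x. tail_prob n A x * (1 - tail_prob n A x)) \<in> borel_measurable E" for n
    using measurable_tail_prob[OF A] by measurable
  from integral_coord_stationary[OF this] show ?thesis
    using tail_prob_variance_tendsto_0[OF lam A] by simp
qed

lemma prob_law_at: "x \<in> space E \<Longrightarrow> prob_space (K x)"
  and sets_law_at: "x \<in> space E \<Longrightarrow> sets (K x) = sets S"
  by (rule law_atD; assumption)+

lemmas tv_tail_law_at = tv_tail[OF prob_law_at sets_law_at lawD(1,3)[OF lam]]

lemma integrable_law_at: "A \<in> sets S \<Longrightarrow> integrable lam (\<lambda>x. measure (K x) A)"
  using measurable_lam[OF measurable_measure_law_at] prob_space.prob_le_1[OF prob_law_at]
  by (intro lam.integrable_bounded_1) (auto simp: space_lam)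

section \<open>Ergodicity, triviality and irreducibility\<close>

text \<open>For fixed \<open>x\<close>, almost every \<open>K x'\<close> agrees with \<open>K x\<close> on a tail event, hence so does their mean,
  the stationary law. Comparing one event at a time leaves integrands that are measurable in \<open>x'\<close>,
  whereas the distance of \<open>K x\<close> and \<open>K x'\<close> would have to be shown measurable first.\<close>

lemma pairwise_imp_ergodic:
  assumes "AE x in lam. AE x' in lam. tv_on T (K x) (K x') = 0"
  shows "AE x in lam. tv_on T (K x) (Q lam) = 0"
  using assms AE_space
proof eventually_elim
  case (elim x)
  then have x: "x \<in> space E" by (simp add: space_lam)
  have "measure (K x) A = measure (Q lam) A" if A: "A \<in> T" for A
  proof -
    have "AE x' in lam. measure (K x') A = measure (K x) A"
      using elim(1) AE_space
    proof eventually_elim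
      case (elim x')
      then show ?case
        using A tv_tail_eq_0_iff[OF prob_law_at[OF x] prob_law_at, of x'] by (auto simp: space_lam)
    qed
    then have "(\<integral>x'. measure (K x') A \<partial>lam) = (\<integral>x'. measure (K x) A \<partial>lam)"
      using measurable_lam[OF measurable_measure_law_at[OF tail_sub[OF A]]]
      by (intro integral_cong_AE) auto
    then show ?thesis by (simp add: measure_stationary[OF tail_sub[OF A]] lam.prob_space)
  qed
  then show ?case using tv_tail_eq_0_iff[OF prob_law_at[OF x] lawD(1)[OF lam]] by simp
qed

text \<open>Almost surely the conditional probabilities of \<open>A\<close> all equal its unconditional probability, while
  their conditional variances tend to zero.\<close>

lemma ergodic_imp_tail_trivial:
  assumes erg: "AE x in lam. tv_on T (K x) (Q lam) = 0" and A: "A \<in> T"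
  shows "measure (Q lam) A * (1 - measure (Q lam) A) = 0"
proof -
  let ?p = "measure (Q lam) A"
  have "(\<integral>x. tail_prob n A x * (1 - tail_prob n A x) \<partial>lam) = ?p * (1 - ?p)" for n
  proof -
    have "AE x in lam. tail_prob n A x = ?p"
      using erg AE_space
    proof eventually_elim
      case (elim x)
      then show ?case
        using tv_tail_eq_0_iff[OF prob_law_at lawD(1)[OF lam], of x] unshift_tail[OF A, of n]
        by (auto simp: space_lam tail_prob_def measure_unshift[OF A])
    qed
    then have "(\<integral>x. tail_prob n A x * (1 - tail_prob n A x) \<partial>lam) = (\<integral>x. ?p * (1 - ?p) \<partial>lam)"
      using measurable_lam[OF measurable_tail_prob[OF A, of n]] by (intro integral_cong_AE) auto
    then show ?thesis by (simp add: lam.prob_space)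
  qed
  with tail_prob_variance_stationary_tendsto_0[OF A] show ?thesis
    by (simp add: LIMSEQ_const_iff)
qed

text \<open>The conditional probabilities of \<open>A\<close> approach 0 or 1, along a subsequence at almost every starting
  point. For two starting points whose tail laws are not mutually singular, they stay at a distance
  bounded below one, so they approach the same limit, and \<open>g n x * (1 - g n x')\<close> tends to zero. By
  stationarity its mean over independent \<open>x\<close> and \<open>x'\<close> is \<open>p * (1 - p)\<close> for every \<open>n\<close>, where \<open>p\<close> is the
  probability of \<open>A\<close>.\<close>

lemma irreducible_imp_tail_trivial:
  assumes irr: "AE x in lam. AE x' in lam. tv_on T (K x) (K x') < 2" and A: "A \<in> T"
  shows "measure (Q lam) A * (1 - measure (Q lam) A) = 0"
proof -
  let ?p = "measure (Q lam) A"
  define g where "g n x = tail_prob n A x" for n x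
  have gm: "g n \<in> borel_measurable lam" for n
    unfolding g_def by (intro measurable_lam measurable_tail_prob A)
  note [measurable] = gm
  have gb: "0 \<le> g n x" "g n x \<le> 1" if "x \<in> space lam" for n x
    using that tail_prob_le_1 by (auto simp: g_def tail_prob_nonneg space_lam)
  have gi: "integrable lam (g n)" "integrable lam (\<lambda>x. g n x * (1 - g n x))" for n
    by (rule lam.integrable_bounded_1; use gb in \<open>force simp: mult_le_one\<close>)+
  have "(\<integral>x. norm (g n x * (1 - g n x)) \<partial>lam) = (\<integral>x. g n x * (1 - g n x) \<partial>lam)" for n
    using gb by (intro Bochner_Integration.integral_cong) auto
  then have "(\<lambda>n. \<integral>x. norm (g n x * (1 - g n x)) \<partial>lam) \<longlonglongrightarrow> 0"
    using tail_prob_variance_stationary_tendsto_0[OF A] by (simp add: g_def)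
  from tendsto_L1_AE_subseq[OF gi(2) this] obtain r :: "nat \<Rightarrow> nat"
    where r: "AE x in lam. (\<lambda>n. g (r n) x * (1 - g (r n) x)) \<longlonglongrightarrow> 0" by blast
  have ig: "(\<integral>x. g n x \<partial>lam) = ?p" for n
    unfolding g_def by (rule integral_tail_prob[OF A])
  have "AE x in lam. (\<lambda>n. g (r n) x * (1 - ?p)) \<longlonglongrightarrow> 0"
    using irr r AE_space
  proof eventually_elim
    case (elim x)
    note x = elim(3)
    have "AE x' in lam. (\<lambda>n. g (r n) x * (1 - g (r n) x')) \<longlonglongrightarrow> 0"
      using elim(1) r AE_space
    proof eventually_elim
      case x': (elim x')
      define c where "c = tv_on T (K x) (K x') / 2"
      have c: "c < 1" using x'(1) by (simp add: c_def)
      have close: "g n x - g n x' \<le> c" for n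
        using abs_le_D1[OF tv_on_upper[OF prob_law_at prob_law_at unshift_tail[OF A]], of x x' n] x x'(3)
        by (simp add: g_def tail_prob_def c_def space_lam)
      have bound: "g n x * (1 - g n x') \<le> (g n x * (1 - g n x) + g n x' * (1 - g n x')) / (1 - c)" for n
      proof -
        note b = gb[OF x, of n] gb[OF x'(3), of n]
        \<comment> \<open>use \<open>1 - c \<le> (1 - g n x) + g n x'\<close>, which produces the two variances\<close>
        have "g n x * (1 - g n x') * (1 - c) \<le> g n x * (1 - g n x') * ((1 - g n x) + g n x')"
          using b close[of n] by (intro mult_left_mono) auto
        also have "\<dots> = g n x * (1 - g n x) * (1 - g n x') + g n x' * (1 - g n x') * g n x"
          by (simp add: algebra_simps)
        also have "\<dots> \<le> g n x * (1 - g n x) + g n x' * (1 - g n x')"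
          using b by (intro add_mono mult_right_le_one_le) auto
        finally show ?thesis using c by (simp add: field_simps)
      qed
      have "(\<lambda>n. (g (r n) x * (1 - g (r n) x) + g (r n) x' * (1 - g (r n) x')) / (1 - c)) \<longlonglongrightarrow> (0 + 0) / (1 - c)"
        using c by (intro tendsto_intros elim(2) x'(2)) auto
      then have "(\<lambda>n. (g (r n) x * (1 - g (r n) x) + g (r n) x' * (1 - g (r n) x')) / (1 - c)) \<longlonglongrightarrow> 0" by simp
      then show ?case
        by (rule real_tendsto_sandwich[OF always_eventually always_eventually tendsto_const, rotated 2])
          (use bound gb[OF x] gb[OF x'(3)] in auto)
    qed
    then have lim: "(\<lambda>n. \<integral>x'. g (r n) x * (1 - g (r n) x') \<partial>lam) \<longlonglongrightarrow> 0"
      using gb gb[OF x] by (intro lam.integral_tendsto_0) (auto simp: abs_mult mult_le_one)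
    have eq: "(\<integral>x'. g n x * (1 - g n x') \<partial>lam) = g n x * (1 - ?p)" for n
      using gi(1) by (simp add: ig lam.prob_space)
    show ?case using lim unfolding eq .
  qed
  then have "(\<lambda>n. \<integral>x. g (r n) x * (1 - ?p) \<partial>lam) \<longlonglongrightarrow> 0"
    using gb by (intro lam.integral_tendsto_0) (auto simp: abs_mult mult_le_one)
  then show ?thesis by (simp add: ig LIMSEQ_const_iff)
qed

text \<open>Otherwise some tail event has probability one under \<open>K x\<close> and zero under the stationary law, hence
  zero under almost every \<open>K x'\<close>, and then \<open>K x\<close> and \<open>K x'\<close> are mutually singular.\<close>

lemma irreducible_imp_not_singular:
  assumes irr: "AE x in lam. AE x' in lam. tv_on T (K x) (K x') < 2"
  shows "AE x in lam. tv_on T (K x) (Q lam) < 2"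
  using irr AE_space
proof eventually_elim
  case (elim x)
  then have x: "x \<in> space E" by (simp add: space_lam)
  interpret Kx: prob_space "K x" by (rule prob_law_at[OF x])
  show ?case
  proof (rule ccontr)
    assume "\<not> tv_on T (K x) (Q lam) < 2"
    moreover obtain A where A: "A \<in> T" "tv_on T (K x) (Q lam) = 2 * (measure (K x) A - measure (Q lam) A)"
      by (rule tv_tail_law_at[OF x x])
    ultimately have "1 \<le> measure (K x) A - measure (Q lam) A" by simp
    then have one: "measure (K x) A = 1" and zero: "measure (Q lam) A = 0"
      using Kx.prob_le_1[of A] measure_nonneg[of "Q lam" A] by linarith+
    have "AE x' in lam. measure (K x') A = 0"
      using zero integral_nonneg_eq_0_iff_AE[OF integrable_law_at[OF tail_sub[OF A(1)]]]
      by (simp add: measure_stationary[OF tail_sub[OF A(1)]])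
    with elim(1) AE_space have "AE x' in lam. False"
    proof eventually_elim
      case (elim x')
      then have "\<bar>measure (K x) A - measure (K x') A\<bar> \<le> tv_on T (K x) (K x') / 2"
        using x by (intro tv_on_upper prob_law_at A) (auto simp: space_lam)
      then show ?case using elim one by simp
    qed
    then show False by simp
  qed
qed

text \<open>This is where the countable generation of \<open>\<E>0\<close> enters. The tail field itself is in general not
  countably generated, so the distance on it is reached as a limit of distances on the futures.\<close>

lemma measurable_tv_tail: "(\<lambda>x. tv_on T (K x) (Q lam)) \<in> borel_measurable E"
proof (rule borel_measurable_LIMSEQ_real)
  show "(\<lambda>n. tv_on (F n) (K x) (Q lam)) \<longlonglongrightarrow> tv_on T (K x) (Q lam)" if "x \<in> space E" for x
    by (rule tv_tail_law_at[OF that that])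
  fix n
  obtain \<C> where C: "countable \<C>" "\<C> \<subseteq> Pow (paths E)" "F n = sigma_sets (paths E) \<C>"
    using coord_field_countable_generator[OF cg, of "{int n..}"] unfolding local_future_def by auto
  obtain G where G: "countable G" "algebra (paths E) G" "sigma_sets (paths E) G = F n"
    using countable_generating_algebra[OF C(1,2)] C(3) by auto
  have GS: "A \<in> sets S" if "A \<in> G" for A using that G(3) future_sub[of n] by auto
  have "tv_on (F n) (K x) (Q lam) = tv_on G (K x) (Q lam)" if x: "x \<in> space E" for x
    using future_sub[of n] G law_atD(1-3)[OF x] lawD(1-3)[OF lam]
    by (intro tv_on_generating_algebra) auto
  moreover have "(\<lambda>x. tv_on G (K x) (Q lam)) \<in> borel_measurable E"
    unfolding tv_on_def
  proof (intro borel_measurable_times borel_measurable_const borel_measurable_cSUP G(1))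
    show "(\<lambda>x. \<bar>measure (K x) A - measure (Q lam) A\<bar>) \<in> borel_measurable E" if "A \<in> G" for A
      using measurable_measure_law_at[OF GS[OF that]] by measurable
    show "bdd_above ((\<lambda>A. \<bar>measure (K x) A - measure (Q lam) A\<bar>) ` G)" if "x \<in> space E" for x
      using tv_on_upper[OF prob_law_at[OF that] lawD(1)[OF lam]]
      by (intro bdd_aboveI2[where M="tv_on G (K x) (Q lam) / 2"]) auto
  qed
  ultimately show "(\<lambda>x. tv_on (F n) (K x) (Q lam)) \<in> borel_measurable E" by (simp cong: measurable_cong)
qed

lemma half_tv_bounds:
  assumes "x \<in> space E"
  shows "0 \<le> tv_on T (K x) (Q lam) / 2" "tv_on T (K x) (Q lam) / 2 \<le> 1"
proof -
  interpret Kx: prob_space "K x" by (rule prob_law_at[OF assms])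
  obtain A where A: "A \<in> T" "tv_on T (K x) (Q lam) = 2 * (measure (K x) A - measure (Q lam) A)"
    by (rule tv_tail_law_at[OF assms assms])
  have "measure (K x) A - measure (Q lam) A \<le> 1"
    using Kx.prob_le_1[of A] measure_nonneg[of "Q lam" A] by linarith
  then show "tv_on T (K x) (Q lam) / 2 \<le> 1" by (simp add: A(2))
  show "0 \<le> tv_on T (K x) (Q lam) / 2"
    using tv_on_nonneg[OF prob_law_at[OF assms] lawD(1)[OF lam], of T] space_in_tail by auto
qed

text \<open>Let \<open>A\<close> attain \<open>h x\<close>; by triviality \<open>A\<close> may be taken null for the stationary law. The conditional
  probabilities \<open>f\<close> of \<open>A\<close> under \<open>K x\<close> have mean \<open>h x\<close> and are bounded by \<open>h\<close> at the current
  coordinate, since \<open>A\<close> seen from time \<open>n\<close> is null as well. As the mean of \<open>f * (1 - f)\<close> vanishes in the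
  limit, \<open>h x\<close> is asymptotically at most the mean of \<open>h\<^sup>2\<close> at time \<open>n\<close>.\<close>

lemma half_tv_minus_mean_square_tendsto_0:
  assumes triv: "\<And>A. A \<in> T \<Longrightarrow> measure (Q lam) A * (1 - measure (Q lam) A) = 0" and x: "x \<in> space E"
  defines "h \<equiv> \<lambda>y. tv_on T (K y) (Q lam) / 2"
  shows "(\<lambda>n. max 0 (h x - (\<integral>\<omega>. (h (\<omega> (int n)))\<^sup>2 \<partial>K x))) \<longlonglongrightarrow> 0"
proof -
  interpret Kx: prob_space "K x" by (rule prob_law_at[OF x])
  note rx = return_in_prob_algebra[OF x]
  have Kx_eq: "Q (return E x) = K x" by (simp add: markov_law_at_def)
  obtain A where A: "A \<in> T" and hA: "tv_on T (K x) (Q lam) = 2 * (measure (K x) A - measure (Q lam) A)"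
    by (rule tv_tail_law_at[OF x x])
  have hx: "h x = measure (K x) A - measure (Q lam) A" by (simp add: h_def hA)
  let ?u = "\<lambda>n. \<integral>\<omega>. (h (\<omega> (int n)))\<^sup>2 \<partial>K x"
  have u0: "0 \<le> ?u n" for n by simp
  show ?thesis
  proof (cases "measure (Q lam) A = 0")
    case False
    \<comment> \<open>an event that is certain for the stationary law cannot witness a positive \<open>h x\<close>\<close>
    then have "measure (Q lam) A = 1" using triv[OF A] by auto
    then have "h x \<le> 0" using hx Kx.prob_le_1[of A] by simp
    then have "h x - ?u n \<le> 0" for n using u0[of n] by linarith
    then show ?thesis by (simp add: max_absorb1)
  next
    case True
    let ?v = "\<lambda>n. \<integral>\<omega>. tail_prob n A (\<omega> (int n)) * (1 - tail_prob n A (\<omega> (int n))) \<partial>K x"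
    have v: "?v \<longlonglongrightarrow> 0" using tail_prob_variance_tendsto_0[OF rx A] unfolding Kx_eq .
    have key: "h x - ?u n \<le> ?v n" for n
    proof -
      define f where "f \<omega> = tail_prob n A (\<omega> (int n))" for \<omega> :: "int \<Rightarrow> 'a"
      have [measurable]: "f \<in> borel_measurable (K x)"
        using measurable_compose_coord[OF rx measurable_tail_prob[OF A, of n], of n] unfolding Kx_eq f_def .
      have hm: "h \<in> borel_measurable E" unfolding h_def using measurable_tv_tail by measurable
      have [measurable]: "(\<lambda>\<omega>. h (\<omega> (int n))) \<in> borel_measurable (K x)"
        using measurable_compose_coord[OF rx hm, of n] unfolding Kx_eq .
      have sp: "\<omega> (int n) \<in> space E" if "\<omega> \<in> space (K x)" for \<omega>
        using that law_atD(2)[OF x] by (simp add: paths_iff)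
      have hb: "0 \<le> h (\<omega> (int n))" "h (\<omega> (int n)) \<le> 1" if "\<omega> \<in> space (K x)" for \<omega>
        using half_tv_bounds[OF sp[OF that]] by (auto simp: h_def)
      have fb: "0 \<le> f \<omega>" "f \<omega> \<le> 1" if "\<omega> \<in> space (K x)" for \<omega>
        using tail_prob_le_1[OF sp[OF that]] by (auto simp: f_def tail_prob_nonneg)
      have fh: "f \<omega> \<le> h (\<omega> (int n))" if "\<omega> \<in> space (K x)" for \<omega>
        using abs_le_D1[OF tv_on_upper[OF prob_law_at[OF sp[OF that]] lawD(1)[OF lam] unshift_tail[OF A, of n]]]
        by (simp add: f_def h_def tail_prob_def measure_unshift[OF A] True)
      have int: "integrable (K x) f" "integrable (K x) (\<lambda>\<omega>. f \<omega> * (1 - f \<omega>))" "integrable (K x) (\<lambda>\<omega>. (h (\<omega> (int n)))\<^sup>2)"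
        by (rule Kx.integrable_bounded_1; use fb hb in \<open>force simp: mult_le_one power_le_one\<close>)+
      have "h x = (\<integral>\<omega>. f \<omega> \<partial>K x)"
        using measure_tail[OF rx A, of n] hx True unfolding Kx_eq by (simp add: f_def)
      also have "\<dots> \<le> (\<integral>\<omega>. f \<omega> * (1 - f \<omega>) + (h (\<omega> (int n)))\<^sup>2 \<partial>K x)"
      proof (rule integral_mono)
        fix \<omega> assume \<omega>: "\<omega> \<in> space (K x)"
        have "(f \<omega>)\<^sup>2 \<le> (h (\<omega> (int n)))\<^sup>2" using fh[OF \<omega>] fb[OF \<omega>] by (intro power_mono)
        then show "f \<omega> \<le> f \<omega> * (1 - f \<omega>) + (h (\<omega> (int n)))\<^sup>2"
          by (simp add: power2_eq_square algebra_simps)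
      qed (use int in auto)
      also have "\<dots> = ?v n + ?u n" using int by (simp add: f_def)
      finally show ?thesis by simp
    qed
    have "(\<lambda>n. max 0 (?v n)) \<longlonglongrightarrow> max 0 0" by (intro tendsto_max tendsto_const v)
    then have "(\<lambda>n. max 0 (?v n)) \<longlonglongrightarrow> 0" by simp
    then show ?thesis
      by (rule real_tendsto_sandwich[OF always_eventually always_eventually tendsto_const, rotated 2])
        (use key max.mono[OF order_refl key] in auto)
  qed
qed

text \<open>Stationarity, disintegrated over the starting point.\<close>

lemma integral_law_at_coord:
  fixes f :: "'a \<Rightarrow> real"
  assumes f: "f \<in> borel_measurable E" and b: "\<And>y. y \<in> space E \<Longrightarrow> 0 \<le> f y \<and> f y \<le> 1"
  shows "(\<lambda>x. \<integral>\<omega>. f (\<omega> (int n)) \<partial>K x) \<in> borel_measurable E"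
    and "(\<integral>x. (\<integral>\<omega>. f (\<omega> (int n)) \<partial>K x) \<partial>lam) = (\<integral>x. f x \<partial>lam)"
    and "x \<in> space E \<Longrightarrow> 0 \<le> (\<integral>\<omega>. f (\<omega> (int n)) \<partial>K x) \<and> (\<integral>\<omega>. f (\<omega> (int n)) \<partial>K x) \<le> 1"
proof -
  have fn: "(\<lambda>\<omega>. f (\<omega> (int n))) \<in> borel_measurable S"
    by (rule measurable_compose[OF measurable_coord f]) simp
  have fnR: "(\<lambda>\<omega>. f (\<omega> (int n))) \<in> borel_measurable R" if "sets R = sets S" for R
    using fn by (simp add: measurable_cong_sets[OF that refl])
  show m: "(\<lambda>x. \<integral>\<omega>. f (\<omega> (int n)) \<partial>K x) \<in> borel_measurable E"
    by (rule measurable_compose[OF measurable_law_at_sub integral_measurable_subprob_algebra[OF fn]])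
  have bR: "0 \<le> f (\<omega> (int n))" "f (\<omega> (int n)) \<le> 1" if "sets R = sets S" "\<omega> \<in> space R" for R \<omega>
    using that b[of "\<omega> (int n)"] sets_eq_imp_space_eq[OF that(1)] by (auto simp: paths_iff)
  have int: "integrable R (\<lambda>\<omega>. f (\<omega> (int n)))" if R: "prob_space R" "sets R = sets S" for R
    by (rule prob_space.integrable_bounded_1[OF R(1) fnR[OF R(2)]]) (use bR[OF R(2)] in auto)
  have nn: "(\<integral>\<^sup>+ \<omega>. ennreal (f (\<omega> (int n))) \<partial>R) = ennreal (\<integral>\<omega>. f (\<omega> (int n)) \<partial>R)"
    if R: "prob_space R" "sets R = sets S" for R
    using bR[OF R(2)] by (intro nn_integral_eq_integral int R) auto
  show bd: "0 \<le> (\<integral>\<omega>. f (\<omega> (int n)) \<partial>K x) \<and> (\<integral>\<omega>. f (\<omega> (int n)) \<partial>K x) \<le> 1" if x: "x \<in> space E" for x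
  proof
    interpret Kx: prob_space "K x" by (rule prob_law_at[OF x])
    show "0 \<le> (\<integral>\<omega>. f (\<omega> (int n)) \<partial>K x)"
      using bR[OF sets_law_at[OF x]] by (intro Bochner_Integration.integral_nonneg) auto
    show "(\<integral>\<omega>. f (\<omega> (int n)) \<partial>K x) \<le> 1"
      using bR[OF sets_law_at[OF x]] by (intro Kx.integral_le_const int prob_law_at sets_law_at x) auto
  qed
  have Km: "K \<in> lam \<rightarrow>\<^sub>M subprob_algebra S"
    using measurable_law_at_sub by (simp add: measurable_cong_sets[OF sets_lam refl])
  have i: "integrable lam (\<lambda>x. \<integral>\<omega>. f (\<omega> (int n)) \<partial>K x)"
    using bd by (intro lam.integrable_bounded_1 measurable_lam m) (auto simp: space_lam)
  have "ennreal (\<integral>x. (\<integral>\<omega>. f (\<omega> (int n)) \<partial>K x) \<partial>lam) = (\<integral>\<^sup>+ x. ennreal (\<integral>\<omega>. f (\<omega> (int n)) \<partial>K x) \<partial>lam)"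
    using bd by (intro nn_integral_eq_integral[symmetric] i) (auto simp: space_lam)
  also have "\<dots> = (\<integral>\<^sup>+ x. (\<integral>\<^sup>+ \<omega>. ennreal (f (\<omega> (int n))) \<partial>K x) \<partial>lam)"
    by (intro nn_integral_cong nn[symmetric] prob_law_at sets_law_at) (auto simp: space_lam)
  also have "\<dots> = (\<integral>\<^sup>+ \<omega>. ennreal (f (\<omega> (int n))) \<partial>Q lam)"
    unfolding law_eq_bind[OF lam] by (intro nn_integral_bind[symmetric, OF _ Km] measurable_compose[OF fn]) auto
  also have "\<dots> = ennreal (\<integral>\<omega>. f (\<omega> (int n)) \<partial>Q lam)" by (rule nn[OF lawD(1,3)[OF lam]])
  also have "\<dots> = ennreal (\<integral>x. f x \<partial>lam)" by (simp add: integral_coord_stationary[OF f])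
  finally have "ennreal (\<integral>x. (\<integral>\<omega>. f (\<omega> (int n)) \<partial>K x) \<partial>lam) = ennreal (\<integral>x. f x \<partial>lam)" .
  moreover have "0 \<le> (\<integral>x. (\<integral>\<omega>. f (\<omega> (int n)) \<partial>K x) \<partial>lam)"
    by (rule Bochner_Integration.integral_nonneg) (use bd in \<open>auto simp: space_lam\<close>)
  moreover have "0 \<le> (\<integral>x. f x \<partial>lam)"
    using b by (intro Bochner_Integration.integral_nonneg) (auto simp: space_lam)
  ultimately show "(\<integral>x. (\<integral>\<omega>. f (\<omega> (int n)) \<partial>K x) \<partial>lam) = (\<integral>x. f x \<partial>lam)" by (simp add: ennreal_inj)
qed

text \<open>Integrating the preceding bound over the stationary law, whose coordinates all have law \<open>lam\<close>,
  yields \<open>\<integral>h \<le> \<integral>h\<^sup>2\<close>. As \<open>h\<close> takes values in the unit interval, it is almost everywhere 0 or 1, and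
  the value 1 is excluded by nonsingularity.\<close>

lemma irreducible_imp_ergodic:
  assumes irr: "AE x in lam. AE x' in lam. tv_on T (K x) (K x') < 2"
  shows "AE x in lam. tv_on T (K x) (Q lam) = 0"
proof -
  define h where "h x = tv_on T (K x) (Q lam) / 2" for x
  have hb: "0 \<le> h x \<and> h x \<le> 1" if "x \<in> space E" for x using half_tv_bounds[OF that] by (simp add: h_def)
  have hm: "h \<in> borel_measurable E" unfolding h_def using measurable_tv_tail by measurable
  have h2m: "(\<lambda>x. (h x)\<^sup>2) \<in> borel_measurable E" using hm by measurable
  have h2b: "0 \<le> (h x)\<^sup>2 \<and> (h x)\<^sup>2 \<le> 1" if "x \<in> space E" for x using hb[OF that] by (auto simp: power_le_one)
  define u where "u n x = (\<integral>\<omega>. (h (\<omega> (int n)))\<^sup>2 \<partial>K x)" for n x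
  note u = integral_law_at_coord[OF h2m h2b, folded u_def]
  have int: "integrable lam h" "integrable lam (\<lambda>x. (h x)\<^sup>2)" "integrable lam (u n)" for n
    using hb h2b u(3) by (auto intro!: lam.integrable_bounded_1 measurable_lam hm h2m u(1) simp: space_lam)
  have w: "(\<lambda>n. \<integral>x. max 0 (h x - u n x) \<partial>lam) \<longlonglongrightarrow> 0"
  proof (rule lam.integral_tendsto_0)
    show "(\<lambda>x. max 0 (h x - u n x)) \<in> borel_measurable lam" for n
      using int by measurable
    show "AE x in lam. (\<lambda>n. max 0 (h x - u n x)) \<longlonglongrightarrow> 0"
      unfolding h_def u_def
      by (rule AE_I2, rule half_tv_minus_mean_square_tendsto_0[OF irreducible_imp_tail_trivial[OF irr]]) (auto simp: space_lam)
    show "\<bar>max 0 (h x - u n x)\<bar> \<le> 1" if "x \<in> space lam" for n x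
      using that hb[of x] u(3)[of x n] by (auto simp: space_lam)
  qed
  have "(\<integral>x. h x - (h x)\<^sup>2 \<partial>lam) \<le> (\<integral>x. max 0 (h x - u n x) \<partial>lam)" for n
  proof -
    have "(\<integral>x. h x - (h x)\<^sup>2 \<partial>lam) = (\<integral>x. h x - u n x \<partial>lam)" using int by (simp add: u(2))
    also have "\<dots> \<le> (\<integral>x. max 0 (h x - u n x) \<partial>lam)"
      using int by (intro integral_mono) auto
    finally show ?thesis .
  qed
  then have "(\<integral>x. h x - (h x)\<^sup>2 \<partial>lam) \<le> 0" by (intro LIMSEQ_le_const[OF w]) auto
  moreover have nn: "0 \<le> h x - (h x)\<^sup>2" if "x \<in> space lam" for x
    using hb[of x] that mult_left_le[of "h x" "h x"] by (simp add: space_lam power2_eq_square)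
  moreover have "0 \<le> (\<integral>x. h x - (h x)\<^sup>2 \<partial>lam)" using nn by (rule Bochner_Integration.integral_nonneg)
  ultimately have "AE x in lam. h x - (h x)\<^sup>2 = 0"
    using int by (subst integral_nonneg_eq_0_iff_AE[symmetric]) auto
  with irreducible_imp_not_singular[OF irr] show ?thesis
    by eventually_elim (auto simp: h_def power2_eq_square)
qed

end

theorem theorem2p2:
  fixes E :: "'a measure" and \<E>0 :: "'a set set"
    and P :: "'a \<Rightarrow> 'a measure" and lam :: "'a measure"
  assumes kernel: "P \<in> E \<rightarrow>\<^sub>M prob_algebra E"
    and sub: "\<E>0 \<subseteq> sets E"
    and cg: "countably_generated (space E) \<E>0"
    and lam: "lam \<in> space (prob_algebra E)"
    and inv: "lam \<bind> P = lam"
  shows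
    "((AE x in lam.
         (\<lambda>n. tv_on (local_future E \<E>0 n) (markov_law_at E P x) (markov_law E P lam)) \<longlonglongrightarrow> 0)
      \<longleftrightarrow>
      (AE (x, x') in lam \<Otimes>\<^sub>M lam.
         (\<lambda>n. tv_on (local_future E \<E>0 n) (markov_law_at E P x) (markov_law_at E P x')) \<longlonglongrightarrow> 0))
     \<and>
     ((AE x in lam.
         (\<lambda>n. tv_on (local_future E \<E>0 n) (markov_law_at E P x) (markov_law E P lam)) \<longlonglongrightarrow> 0)
      \<longleftrightarrow>
      (AE (x, x') in lam \<Otimes>\<^sub>M lam.
         \<forall>A\<in>local_tail E \<E>0.
           measure (markov_law_at E P x) A = (measure (markov_law_at E P x) A)\<^sup>2 \<and>
           (measure (markov_law_at E P x) A)\<^sup>2 = measure (markov_law_at E P x') A))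
     \<and>
     ((AE (x, x') in lam \<Otimes>\<^sub>M lam.
         \<forall>A\<in>local_tail E \<E>0.
           measure (markov_law_at E P x) A = (measure (markov_law_at E P x) A)\<^sup>2 \<and>
           (measure (markov_law_at E P x) A)\<^sup>2 = measure (markov_law_at E P x') A)
      \<longleftrightarrow>
      (AE (x, x') in lam \<Otimes>\<^sub>M lam.
         \<exists>n::nat. tv_on (local_future E \<E>0 n) (markov_law_at E P x) (markov_law_at E P x') < 2))"
    (is "(?erg \<longleftrightarrow> ?pair) \<and> (?erg \<longleftrightarrow> ?triv) \<and> (?triv \<longleftrightarrow> ?irr)")
proof -
  interpret local_chain E P \<E>0 lam by standard (fact assms)+
  interpret LL: pair_prob_space lam lam by standard
  have AE_pair_cong: "(AE (x, x') in lam \<Otimes>\<^sub>M lam. R x x') \<longleftrightarrow> (AE (x, x') in lam \<Otimes>\<^sub>M lam. R' x x')"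
    if "\<And>x x'. x \<in> space E \<Longrightarrow> x' \<in> space E \<Longrightarrow> R x x' \<longleftrightarrow> R' x x'" for R R'
    using that by (intro AE_cong) (auto simp: space_pair_measure space_lam)
  have iterate: "AE x in lam. AE x' in lam. R x x'" if "AE (x, x') in lam \<Otimes>\<^sub>M lam. R x x'" for R
    using LL.AE_pair[OF that] by simp
  have erg: "?erg \<longleftrightarrow> (AE x in lam. tv_on T (K x) (Q lam) = 0)"
    by (intro AE_cong tv_future_tendsto_0_iff prob_law_at sets_law_at lawD lam) (auto simp: space_lam)
  have pair: "?pair \<longleftrightarrow> (AE (x, x') in lam \<Otimes>\<^sub>M lam. tv_on T (K x) (K x') = 0)"
    by (intro AE_pair_cong tv_future_tendsto_0_iff prob_law_at sets_law_at)
  have irr: "?irr \<longleftrightarrow> (AE (x, x') in lam \<Otimes>\<^sub>M lam. tv_on T (K x) (K x') < 2)"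
    by (intro AE_pair_cong tv_future_less_iff prob_law_at sets_law_at)
  have erg_triv: ?triv if ?erg
  proof -
    have e: "AE x in lam. tv_on T (K x) (Q lam) = 0" using that erg by simp
    have "AE x in lam. x \<in> space E \<and> tv_on T (K x) (Q lam) = 0"
      using e AE_space by eventually_elim (simp add: space_lam)
    from AE_pair_measure_both[OF lam.prob_space_axioms this] show ?triv
    proof (rule AE_mp, intro AE_I2 impI)
      fix z assume z: "case z of (x, y) \<Rightarrow> (x \<in> space E \<and> tv_on T (K x) (Q lam) = 0)
        \<and> y \<in> space E \<and> tv_on T (K y) (Q lam) = 0"
      obtain x x' where zz: "z = (x, x')" by (cases z)
      have eq: "measure (K y) A = measure (Q lam) A" if "y \<in> {x, x'}" "A \<in> T" for y A
        using that z zz tv_tail_eq_0_iff[OF prob_law_at lawD(1)[OF lam], of y] by auto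
      have sq: "measure (Q lam) A = (measure (Q lam) A)\<^sup>2" if "A \<in> T" for A
        using ergodic_imp_tail_trivial[OF e that] by (auto simp: power2_eq_square algebra_simps)
      show "case z of (x, x') \<Rightarrow> \<forall>A\<in>T. measure (K x) A = (measure (K x) A)\<^sup>2 \<and> (measure (K x) A)\<^sup>2 = measure (K x') A"
        unfolding zz using eq sq by simp
    qed
  qed
  have triv_pair: ?pair if ?triv
    unfolding pair
  proof (rule AE_mp[OF that], intro AE_I2 impI)
    fix z assume z: "z \<in> space (lam \<Otimes>\<^sub>M lam)" "case z of (x, x') \<Rightarrow> \<forall>A\<in>T. measure (K x) A = (measure (K x) A)\<^sup>2
      \<and> (measure (K x) A)\<^sup>2 = measure (K x') A"
    obtain x x' where zz: "z = (x, x')" by (cases z)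
    then have "x \<in> space E" "x' \<in> space E" using z(1) by (auto simp: space_pair_measure space_lam)
    then show "case z of (x, x') \<Rightarrow> tv_on T (K x) (K x') = 0"
      using z(2) zz tv_tail_eq_0_iff[OF prob_law_at prob_law_at, of x x'] by auto
  qed
  have pair_erg: ?erg if ?pair
    unfolding erg by (rule pairwise_imp_ergodic[OF iterate]) (use that pair in simp)
  have pair_irr: ?irr if ?pair
    unfolding irr using that[unfolded pair] by (rule AE_mp) (auto intro!: AE_I2)
  have irr_erg: ?erg if ?irr
    unfolding erg by (rule irreducible_imp_ergodic[OF iterate]) (use that irr in simp)
  show ?thesis using erg_triv triv_pair pair_erg pair_irr irr_erg by blast
qed

end
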